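(* Suppose $(T_1,\ldots,T_n)$ and $(S_1,\ldots,S_m)$ are an $n$-tuple and an $m$-tuple of operators on a Hilbert space $H$ satisfying (i) $\sum_i T_iT_i^*\leq I$ and $\sum_j S_jS_j^*\leq I$; (ii) there is a unitary matrix $u=(u_{(i,j),(k,l)})$, whose rows and columns are indexed by $\{1,\ldots,n\}\times\{1,\ldots,m\}$, such that for all $1\leq i\leq n$ and $1\leq j\leq m$, $$T_iS_j=\sum_{k,l}u_{(i,j),(k,l)}\,S_lT_k .$$ Then there is a Hilbert space $K$ containing $H$, an $n$-tuple of isometries $(V_1,\ldots,V_n)$ in $B(K)$ and an $m$-tuple of isometries $(U_1,\ldots,U_m)$ in $B(K)$ such that (a) $\sum_i V_iV_i^*\leq I$ and $\sum_j U_jU_j^*\leq I$ (that is, in each tuple the isometries have pairwise orthogonal ranges); (b) for every $1\leq i\leq n$ and $1\leq j\leq m$, $$V_iU_j=\sum_{k,l}u_{(i,j),(k,l)}\,U_lV_k ;$$ (c) each $V_i$ and each $U_j$ leaves $K\ominus H$ invariant; (d) for every $1\leq i\leq n$ and $1\leq j\leq m$, $P_HV_i|_H=T_i$ and $P_HU_j|_H=S_j$ (and, together with (c), this implies that each product involving $V_i$'s and $U_j$'s dilates the corresponding product with $T_i$'s and $S_j$'s).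
   Context: $P_H$ denotes the orthogonal projection of $K$ onto $H$. An operator $B\in B(K)$ dilates $C\in B(H)$ here means $P_HB|_H=C$. *)

theory Defs
  imports "HOL-Analysis.Analysis"
begin

section \<open>Complex Hilbert spaces\<close>

text \<open>
  The complex inner product is linear in its first argument.  Norm, metric and topology are those
  of the underlying real inner product \<open>Re \<langle>x, y\<rangle>\<close>; positive definiteness of \<open>cinner\<close> follows from
  that of \<open>inner\<close>, because \<open>\<langle>x, x\<rangle>\<close> is real by conjugate symmetry.
\<close>

class complex_inner = real_inner +
  fixes scaleC :: "complex \<Rightarrow> 'a \<Rightarrow> 'a"  (infixr \<open>*\<^sub>C\<close> 75)
    and cinner :: "'a \<Rightarrow> 'a \<Rightarrow> complex"
  assumes scaleC_add_right: "a *\<^sub>C (x + y) = a *\<^sub>C x + a *\<^sub>C y"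
    and scaleC_add_left: "(a + b) *\<^sub>C x = a *\<^sub>C x + b *\<^sub>C x"
    and scaleC_scaleC: "a *\<^sub>C (b *\<^sub>C x) = (a * b) *\<^sub>C x"
    and scaleR_scaleC: "r *\<^sub>R x = complex_of_real r *\<^sub>C x"
    and cinner_commute: "cinner x y = cnj (cinner y x)"
    and cinner_add_left: "cinner (x + y) z = cinner x z + cinner y z"
    and cinner_scaleC_left: "cinner (a *\<^sub>C x) y = a * cinner x y"
    and inner_cinner: "inner x y = Re (cinner x y)"

class complex_hilbert = complex_inner + complete_space

instantiation complex :: complex_hilbert
begin
definition scaleC_complex :: "complex \<Rightarrow> complex \<Rightarrow> complex" where "scaleC_complex a x = a * x"
definition cinner_complex :: "complex \<Rightarrow> complex \<Rightarrow> complex" where "cinner_complex x y = x * cnj y"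
instance
  by standard
    (auto simp: scaleC_complex_def cinner_complex_def algebra_simps scaleR_conv_of_real
      inner_complex_def)
end

lemma scaleC_one: "1 *\<^sub>C x = (x :: 'a::complex_inner)"
  using scaleR_scaleC[of 1 x] by simp

lemma cinner_add_right: "cinner x (y + z) = cinner x y + cinner x (z :: 'a::complex_inner)"
  by (metis cinner_add_left cinner_commute complex_cnj_add)

lemma cinner_scaleC_right: "cinner x (a *\<^sub>C y) = cnj a * cinner x (y :: 'a::complex_inner)"
  by (metis cinner_scaleC_left cinner_commute complex_cnj_mult)

lemma cinner_self: "cinner x x = complex_of_real ((norm (x :: 'a::complex_inner))\<^sup>2)"
proof -
  have "Im (cinner x x) = 0"
    using arg_cong[OF cinner_commute[of x x], of Im] by simp
  moreover have "Re (cinner x x) = (norm x)\<^sup>2"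
    by (simp add: inner_cinner[symmetric] power2_norm_eq_inner)
  ultimately show ?thesis by (simp add: complex_eq_iff)
qed

lemma norm_scaleC: "norm (a *\<^sub>C x) = norm a * norm (x :: 'a::complex_inner)"
proof -
  have "complex_of_real ((norm (a *\<^sub>C x))\<^sup>2) = (a * cnj a) * complex_of_real ((norm x)\<^sup>2)"
    unfolding cinner_self[symmetric] by (simp add: cinner_scaleC_left cinner_scaleC_right)
  also have "\<dots> = complex_of_real ((norm a * norm x)\<^sup>2)"
    by (simp only: complex_norm_square[symmetric] power_mult_distrib of_real_mult)
  finally have "(norm (a *\<^sub>C x))\<^sup>2 = (norm a * norm x)\<^sup>2"
    by (simp only: of_real_eq_iff)
  then show ?thesis by simp
qed

lemma norm_cinner_le: "norm (cinner x y) \<le> (norm x)\<^sup>2 + (norm (y :: 'a::complex_inner))\<^sup>2"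
proof -
  have re: "\<bar>Re (cinner v y)\<bar> \<le> ((norm v)\<^sup>2 + (norm y)\<^sup>2) / 2" for v
  proof -
    have "\<bar>Re (cinner v y)\<bar> \<le> norm v * norm y"
      using Cauchy_Schwarz_ineq2[of v y] by (simp add: inner_cinner)
    also have "\<dots> \<le> ((norm v)\<^sup>2 + (norm y)\<^sup>2) / 2"
      using sum_squares_bound[of "norm v" "norm y"] by simp
    finally show ?thesis .
  qed
  have "\<bar>Im (cinner x y)\<bar> \<le> ((norm x)\<^sup>2 + (norm y)\<^sup>2) / 2"
    using re[of "\<i> *\<^sub>C x"] by (simp add: cinner_scaleC_left norm_scaleC)
  with re[of x] show ?thesis
    using cmod_le[of "cinner x y"] by simp
qed


section \<open>Square-summable families\<close>

text \<open>The Hilbert space direct sum of copies of \<open>'a\<close> indexed by \<open>'i\<close>.  Existence of a Hilbert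
  space of dimension at most \<open>aleph_0\<close> times that of \<open>'a\<close> can be expressed as existence of a closed subspace of
  \<open>(nat, 'a) ell2\<close>, since types cannot be quantified existentially.\<close>

typedef (overloaded) ('i, 'a::complex_inner) ell2 =
    "{f :: 'i \<Rightarrow> 'a. (\<lambda>i. (norm (f i))\<^sup>2) summable_on UNIV}"
  morphisms ell2_nth Abs_ell2
  by (rule exI[of _ "\<lambda>_. 0"]) simp

setup_lifting type_definition_ell2

lemma summable_ell2_nth: "(\<lambda>i. (norm (ell2_nth x i))\<^sup>2) summable_on UNIV"
  using ell2_nth[of x] by simp

lemma summable_on_real_comparison:
  fixes f g :: "'i \<Rightarrow> real"
  assumes "g summable_on A" "\<And>i. 0 \<le> f i" "\<And>i. f i \<le> g i"
  shows "f summable_on A"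
proof (rule nonneg_bdd_above_summable_on)
  show "bdd_above (sum f ` {F. F \<subseteq> A \<and> finite F})"
  proof (rule bdd_aboveI2)
    fix F assume "F \<in> {F. F \<subseteq> A \<and> finite F}"
    then have "sum g F \<le> infsum g A"
      using assms by (intro finite_sum_le_infsum) (auto intro: order_trans)
    moreover have "sum f F \<le> sum g F" using assms by (intro sum_mono)
    ultimately show "sum f F \<le> infsum g A" by linarith
  qed
qed (use assms in auto)

lemma norm_add_sq_le: "(norm (x + y))\<^sup>2 \<le> 2 * (norm x)\<^sup>2 + 2 * (norm (y :: 'a::real_normed_vector))\<^sup>2"
proof -
  have "(norm (x + y))\<^sup>2 \<le> (norm x + norm y)\<^sup>2"
    by (intro power_mono norm_triangle_ineq) simp
  also have "\<dots> \<le> 2 * (norm x)\<^sup>2 + 2 * (norm y)\<^sup>2"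
    using sum_squares_bound[of "norm x" "norm y"] by (simp add: power2_sum)
  finally show ?thesis .
qed

lemma square_summable_add:
  fixes f g :: "'i \<Rightarrow> 'a::real_normed_vector"
  assumes "(\<lambda>i. (norm (f i))\<^sup>2) summable_on A" "(\<lambda>i. (norm (g i))\<^sup>2) summable_on A"
  shows "(\<lambda>i. (norm (f i + g i))\<^sup>2) summable_on A"
  by (rule summable_on_real_comparison[where g = "\<lambda>i. 2 * (norm (f i))\<^sup>2 + 2 * (norm (g i))\<^sup>2"])
    (auto intro!: summable_on_add summable_on_cmult_right assms norm_add_sq_le)

lemma summable_cinner:
  "(\<lambda>i. cinner (ell2_nth x i) (ell2_nth y i)) summable_on UNIV"
proof (rule abs_summable_summable)
  show "(\<lambda>i. norm (cinner (ell2_nth x i) (ell2_nth y i))) summable_on UNIV"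
    by (rule summable_on_real_comparison
          [where g = "\<lambda>i. (norm (ell2_nth x i))\<^sup>2 + (norm (ell2_nth y i))\<^sup>2"])
      (auto intro: summable_on_add summable_ell2_nth norm_cinner_le)
qed

instantiation ell2 :: (type, complex_inner) complex_inner
begin

lift_definition zero_ell2 :: "('a, 'b) ell2" is "\<lambda>_. 0" by simp

lift_definition plus_ell2 :: "('a, 'b) ell2 \<Rightarrow> ('a, 'b) ell2 \<Rightarrow> ('a, 'b) ell2"
  is "\<lambda>f g i. f i + g i" by (rule square_summable_add)

lift_definition uminus_ell2 :: "('a, 'b) ell2 \<Rightarrow> ('a, 'b) ell2"
  is "\<lambda>f i. - f i" by simp

lift_definition minus_ell2 :: "('a, 'b) ell2 \<Rightarrow> ('a, 'b) ell2 \<Rightarrow> ('a, 'b) ell2"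
  is "\<lambda>f g i. f i - g i"
  subgoal for f g using square_summable_add[of f UNIV "\<lambda>i. - g i"] by simp
  done

lift_definition scaleR_ell2 :: "real \<Rightarrow> ('a, 'b) ell2 \<Rightarrow> ('a, 'b) ell2"
  is "\<lambda>r f i. r *\<^sub>R f i"
  by (simp add: power_mult_distrib summable_on_cmult_right)

lift_definition scaleC_ell2 :: "complex \<Rightarrow> ('a, 'b) ell2 \<Rightarrow> ('a, 'b) ell2"
  is "\<lambda>a f i. a *\<^sub>C f i"
  by (simp add: power_mult_distrib norm_scaleC summable_on_cmult_right)

definition cinner_ell2 :: "('a, 'b) ell2 \<Rightarrow> ('a, 'b) ell2 \<Rightarrow> complex" where
  "cinner_ell2 x y = (\<Sum>\<^sub>\<infinity>i. cinner (ell2_nth x i) (ell2_nth y i))"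

definition inner_ell2 :: "('a, 'b) ell2 \<Rightarrow> ('a, 'b) ell2 \<Rightarrow> real" where
  "inner_ell2 x y = Re (cinner x y)"

definition norm_ell2 :: "('a, 'b) ell2 \<Rightarrow> real" where
  "norm_ell2 x = sqrt (inner x x)"

definition dist_ell2 :: "('a, 'b) ell2 \<Rightarrow> ('a, 'b) ell2 \<Rightarrow> real" where
  "dist_ell2 x y = norm (x - y)"

definition sgn_ell2 :: "('a, 'b) ell2 \<Rightarrow> ('a, 'b) ell2" where
  "sgn_ell2 x = inverse (norm x) *\<^sub>R x"

definition uniformity_ell2 :: "(('a, 'b) ell2 \<times> ('a, 'b) ell2) filter" where
  "uniformity_ell2 = (INF e\<in>{0 <..}. principal {(x, y). dist x y < e})"

definition open_ell2 :: "('a, 'b) ell2 set \<Rightarrow> bool" where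
  "open_ell2 U \<longleftrightarrow> (\<forall>x\<in>U. eventually (\<lambda>(x', y). x' = x \<longrightarrow> y \<in> U) uniformity)"

instance
proof
  fix x y z :: "('a, 'b) ell2" and a b :: complex and r s :: real
  show "x + y + z = x + (y + z)" "x + y = y + x" "0 + x = x" "- x + x = 0" "x - y = x + - y"
    by (transfer; simp add: algebra_simps)+
  show "r *\<^sub>R (x + y) = r *\<^sub>R x + r *\<^sub>R y" "(r + s) *\<^sub>R x = r *\<^sub>R x + s *\<^sub>R x"
    "r *\<^sub>R s *\<^sub>R x = (r * s) *\<^sub>R x" "1 *\<^sub>R x = x"
    by (transfer; simp add: algebra_simps)+
  show "a *\<^sub>C (x + y) = a *\<^sub>C x + a *\<^sub>C y" "(a + b) *\<^sub>C x = a *\<^sub>C x + b *\<^sub>C x"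
    "a *\<^sub>C b *\<^sub>C x = (a * b) *\<^sub>C x" "r *\<^sub>R x = complex_of_real r *\<^sub>C x"
    by (transfer; simp add: scaleC_add_right scaleC_add_left scaleC_scaleC scaleR_scaleC)+
  show comm: "cinner x y = cnj (cinner y x)" for x y :: "('a, 'b) ell2"
    unfolding cinner_ell2_def infsum_cnj[symmetric] by (simp add: cinner_commute[symmetric])
  show add: "cinner (x + y) z = cinner x z + cinner y z"
    unfolding cinner_ell2_def
    by (simp add: plus_ell2.rep_eq cinner_add_left infsum_add summable_cinner)
  show scale: "cinner (a *\<^sub>C x) y = a * cinner x y" for a
    unfolding cinner_ell2_def by (simp add: scaleC_ell2.rep_eq cinner_scaleC_left infsum_cmult_right')
  have scaleR: "r *\<^sub>R x = complex_of_real r *\<^sub>C x"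
    by (transfer; simp add: scaleR_scaleC)
  show "inner x y = Re (cinner x y)" by (rule inner_ell2_def)
  show "inner x y = inner y x" using comm[of x y] by (simp add: inner_ell2_def)
  show "inner (x + y) z = inner x z + inner y z" by (simp add: inner_ell2_def add)
  show "inner (r *\<^sub>R x) y = r * inner x y" by (simp add: inner_ell2_def scale scaleR)
  have sq: "inner x x = (\<Sum>\<^sub>\<infinity>i. (norm (ell2_nth x i))\<^sup>2)"
    unfolding inner_ell2_def cinner_ell2_def infsum_Re[OF summable_cinner, symmetric]
    by (simp add: cinner_self)
  show "0 \<le> inner x x" unfolding sq by (rule infsum_nonneg) simp
  show "inner x x = 0 \<longleftrightarrow> x = 0"
  proof
    assume "inner x x = 0"
    then have "(norm (ell2_nth x i))\<^sup>2 = 0" for i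
      by (intro nonneg_infsum_le_0D[OF _ summable_ell2_nth]) (auto simp: sq)
    then have "ell2_nth x = (\<lambda>_. 0)" by auto
    then show "x = 0" by (simp add: ell2_nth_inject[symmetric] zero_ell2.rep_eq)
  next
    assume "x = 0"
    then show "inner x x = 0" unfolding sq by (simp add: zero_ell2.rep_eq)
  qed
qed (rule norm_ell2_def dist_ell2_def sgn_ell2_def uniformity_ell2_def open_ell2_def)+

end

lemma norm_ell2_sq: "(norm x)\<^sup>2 = (\<Sum>\<^sub>\<infinity>i. (norm (ell2_nth x i))\<^sup>2)"
proof -
  have "(norm x)\<^sup>2 = Re (cinner x x)" by (simp add: cinner_self)
  then show ?thesis
    unfolding cinner_ell2_def infsum_Re[OF summable_cinner, symmetric] by (simp add: cinner_self)
qed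

lemma sum_nth_le_norm_ell2:
  assumes "finite F" shows "(\<Sum>i\<in>F. (norm (ell2_nth x i))\<^sup>2) \<le> (norm x)\<^sup>2"
  unfolding norm_ell2_sq by (rule finite_sum_le_infsum[OF summable_ell2_nth assms]) auto

lemma norm_nth_le_norm_ell2: "norm (ell2_nth x i) \<le> norm x"
  using sum_nth_le_norm_ell2[of "{i}" x] by simp

instance ell2 :: (type, complex_hilbert) complex_hilbert
proof
  fix X :: "nat \<Rightarrow> ('a, 'b) ell2"
  assume X: "Cauchy X"
  have "Cauchy (\<lambda>n. ell2_nth (X n) i)" for i
  proof (rule metric_CauchyI)
    fix e :: real assume "0 < e"
    then obtain M where M: "\<And>m n. m \<ge> M \<Longrightarrow> n \<ge> M \<Longrightarrow> dist (X m) (X n) < e"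
      using X by (metis metric_CauchyD)
    have "dist (ell2_nth (X m) i) (ell2_nth (X n) i) \<le> dist (X m) (X n)" for m n
      using norm_nth_le_norm_ell2[of "X m - X n" i] by (simp add: dist_norm minus_ell2.rep_eq)
    with M show "\<exists>M. \<forall>m\<ge>M. \<forall>n\<ge>M. dist (ell2_nth (X m) i) (ell2_nth (X n) i) < e"
      by (meson le_less_trans)
  qed
  then have "\<exists>l. (\<lambda>n. ell2_nth (X n) i) \<longlonglongrightarrow> l" for i
    using Cauchy_convergent convergent_def by blast
  then obtain l where l: "\<And>i. (\<lambda>n. ell2_nth (X n) i) \<longlonglongrightarrow> l i"
    by metis
  have tail: "\<exists>M. \<forall>n\<ge>M. \<forall>F. finite F \<longrightarrow> (\<Sum>i\<in>F. (norm (ell2_nth (X n) i - l i))\<^sup>2) \<le> e\<^sup>2"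
    if "0 < e" for e
  proof -
    obtain M where M: "\<And>m n. m \<ge> M \<Longrightarrow> n \<ge> M \<Longrightarrow> norm (X n - X m) < e"
      using X \<open>0 < e\<close> by (metis CauchyD)
    show ?thesis
    proof (intro exI allI impI)
      fix n and F :: "'a set" assume n: "n \<ge> M" and F: "finite F"
      have "(\<lambda>m. \<Sum>i\<in>F. (norm (ell2_nth (X n) i - ell2_nth (X m) i))\<^sup>2)
          \<longlonglongrightarrow> (\<Sum>i\<in>F. (norm (ell2_nth (X n) i - l i))\<^sup>2)"
        by (intro tendsto_intros l)
      moreover have "(\<Sum>i\<in>F. (norm (ell2_nth (X n) i - ell2_nth (X m) i))\<^sup>2) \<le> e\<^sup>2" if "m \<ge> M" for m
      proof -
        have "(\<Sum>i\<in>F. (norm (ell2_nth (X n) i - ell2_nth (X m) i))\<^sup>2) \<le> (norm (X n - X m))\<^sup>2"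
          using sum_nth_le_norm_ell2[OF F, of "X n - X m"] by (simp add: minus_ell2.rep_eq)
        also have "\<dots> \<le> e\<^sup>2" using M[OF that n] by (intro power_mono) auto
        finally show ?thesis .
      qed
      ultimately show "(\<Sum>i\<in>F. (norm (ell2_nth (X n) i - l i))\<^sup>2) \<le> e\<^sup>2"
        by (intro LIMSEQ_le_const2) auto
    qed
  qed
  have diff: "(\<lambda>i. (norm (ell2_nth (X n) i - l i))\<^sup>2) summable_on UNIV"
    if "\<forall>F. finite F \<longrightarrow> (\<Sum>i\<in>F. (norm (ell2_nth (X n) i - l i))\<^sup>2) \<le> c" for n c
    by (rule nonneg_bdd_above_summable_on) (use that in \<open>auto intro!: bdd_aboveI2\<close>)
  obtain M where M: "\<forall>F. finite F \<longrightarrow> (\<Sum>i\<in>F. (norm (ell2_nth (X M) i - l i))\<^sup>2) \<le> 1\<^sup>2"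
    using tail[of 1] by auto
  have "(\<lambda>i. (norm (l i))\<^sup>2) summable_on UNIV"
    using square_summable_add[OF summable_ell2_nth[of "- X M"] diff[OF M]]
    by (simp add: uminus_ell2.rep_eq)
  then obtain y where y: "ell2_nth y = l"
    by (metis Abs_ell2_inverse mem_Collect_eq)
  have "X \<longlonglongrightarrow> y"
  proof (rule LIMSEQ_I)
    fix e :: real assume "0 < e"
    then obtain N where N: "\<And>n F. n \<ge> N \<Longrightarrow> finite F \<Longrightarrow>
        (\<Sum>i\<in>F. (norm (ell2_nth (X n) i - l i))\<^sup>2) \<le> (e/2)\<^sup>2"
      using tail[of "e/2"] by auto
    have "norm (X n - y) < e" if "n \<ge> N" for n
    proof -
      have "(norm (X n - y))\<^sup>2 \<le> (e/2)\<^sup>2"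
        unfolding norm_ell2_sq
        by (rule infsum_le_finite_sums[OF summable_ell2_nth])
          (simp add: minus_ell2.rep_eq y N[OF that])
      then have "norm (X n - y) \<le> e/2"
        using \<open>0 < e\<close> by (simp add: power2_le_iff_abs_le)
      with \<open>0 < e\<close> show ?thesis by simp
    qed
    then show "\<exists>no. \<forall>n\<ge>no. norm (X n - y) < e" by blast
  qed
  then show "convergent X" by (auto simp: convergent_def)
qed


section \<open>Subspaces and operators\<close>

text \<open>
  A closed complex subspace \<open>K\<close> of a type of class \<open>complex_hilbert\<close> is itself a Hilbert space;
  \<open>UNIV\<close> is the whole type.  An operator on \<open>K\<close> is a function on the ambient type of which only
  the values on \<open>K\<close> matter.
\<close>

definition closed_csubspace :: "'a::complex_inner set \<Rightarrow> bool" where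
  "closed_csubspace K \<longleftrightarrow> closed K \<and> 0 \<in> K \<and>
     (\<forall>x\<in>K. \<forall>y\<in>K. x + y \<in> K) \<and> (\<forall>a. \<forall>x\<in>K. a *\<^sub>C x \<in> K)"

definition clinear_on :: "'a::complex_inner set \<Rightarrow> ('a \<Rightarrow> 'b::complex_inner) \<Rightarrow> bool" where
  "clinear_on K T \<longleftrightarrow> (\<forall>x\<in>K. \<forall>y\<in>K. T (x + y) = T x + T y) \<and> (\<forall>a. \<forall>x\<in>K. T (a *\<^sub>C x) = a *\<^sub>C T x)"

definition bounded_operator_on :: "'a::complex_inner set \<Rightarrow> ('a \<Rightarrow> 'a) \<Rightarrow> bool" where
  "bounded_operator_on K T \<longleftrightarrow> T \<in> K \<rightarrow> K \<and> clinear_on K T \<and> (\<exists>c. \<forall>x\<in>K. norm (T x) \<le> c * norm x)"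

definition isometry_on :: "'a::complex_inner set \<Rightarrow> ('a \<Rightarrow> 'b::complex_inner) \<Rightarrow> bool" where
  "isometry_on K V \<longleftrightarrow> clinear_on K V \<and> (\<forall>x\<in>K. norm (V x) = norm x)"

definition adjoint_on :: "'a::complex_inner set \<Rightarrow> ('a \<Rightarrow> 'a) \<Rightarrow> 'a \<Rightarrow> 'a" where
  "adjoint_on K T y = (THE z. z \<in> K \<and> (\<forall>x\<in>K. cinner (T x) y = cinner x z))"

definition op_le_on :: "'a::complex_inner set \<Rightarrow> ('a \<Rightarrow> 'a) \<Rightarrow> ('a \<Rightarrow> 'a) \<Rightarrow> bool" where
  "op_le_on K A B \<longleftrightarrow> (\<forall>x\<in>K. cinner (B x - A x) x \<in> \<real>\<^sub>\<ge>\<^sub>0)"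

definition orth_compl_in :: "'a::complex_inner set \<Rightarrow> 'a set \<Rightarrow> 'a set" where
  "orth_compl_in K M = {x \<in> K. \<forall>y\<in>M. cinner x y = 0}"

definition orth_proj :: "'a::complex_inner set \<Rightarrow> 'a \<Rightarrow> 'a" where
  "orth_proj M x = (THE y. y \<in> M \<and> (\<forall>z\<in>M. cinner (x - y) z = 0))"

text \<open>
  \<open>dilates J B C\<close> says \<open>P\<^sub>H B|\<^sub>H = C\<close>, where the Hilbert space \<open>H\<close> is identified with its image
  under the isometric embedding \<open>J\<close>.
\<close>

definition dilates :: "('a::complex_inner \<Rightarrow> 'b::complex_inner) \<Rightarrow> ('b \<Rightarrow> 'b) \<Rightarrow> ('a \<Rightarrow> 'a) \<Rightarrow> bool" where
  "dilates J B C \<longleftrightarrow> (\<forall>h. orth_proj (range J) (B (J h)) = J (C h))"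

text \<open>
  The product of operators spelled by a word, where \<open>Inl i\<close> stands for \<open>A i\<close> and \<open>Inr j\<close> for \<open>B j\<close>.
\<close>

primrec word_op :: "('i \<Rightarrow> 'a \<Rightarrow> 'a) \<Rightarrow> ('j \<Rightarrow> 'a \<Rightarrow> 'a) \<Rightarrow> ('i + 'j) list \<Rightarrow> 'a \<Rightarrow> 'a" where
  "word_op A B [] = id"
| "word_op A B (c # w) = case_sum A B c \<circ> word_op A B w"

definition row_contraction_on ::
    "'a::complex_inner set \<Rightarrow> 'i set \<Rightarrow> ('i \<Rightarrow> 'a \<Rightarrow> 'a) \<Rightarrow> bool" where
  "row_contraction_on K I T \<longleftrightarrow> op_le_on K (\<lambda>x. \<Sum>i\<in>I. T i (adjoint_on K (T i) x)) (\<lambda>x. x)"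

definition unitary_matrix_on :: "'i set \<Rightarrow> ('i \<Rightarrow> 'i \<Rightarrow> complex) \<Rightarrow> bool" where
  "unitary_matrix_on I u \<longleftrightarrow>
     (\<forall>p\<in>I. \<forall>q\<in>I. (\<Sum>r\<in>I. u p r * cnj (u q r)) = (if p = q then 1 else 0)) \<and>
     (\<forall>p\<in>I. \<forall>q\<in>I. (\<Sum>r\<in>I. cnj (u r p) * u r q) = (if p = q then 1 else 0))"

end

theory Submission
  imports Defs
begin

text \<open>
  The proof follows Ando's construction for a pair of commuting contractions.  Each row contraction
  has an isometric dilation of the form \<open>(h, l) \<mapsto> (T\<^sub>i h, d\<^sub>i h + A\<^sub>i l)\<close> on \<open>H \<oplus> L\<close>: the defect map \<open>d\<close>
  satisfies \<open>d\<^sup>*d = 1 - T\<^sup>*T\<close>, and the \<open>A\<^sub>i\<close> are isometries of \<open>L\<close> whose ranges are orthogonal to each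
  other and to that of \<open>d\<close>.  An operator of this triangular form leaves \<open>L\<close> invariant and compresses to
  \<open>T\<^sub>i\<close>, and both properties pass to products.  What fails is the commutation relation, and only in the
  component in \<open>L\<close>.  There the two sides of the relation are isometrically equivalent, because their
  components in \<open>H\<close> agree, so a unitary \<open>G\<close> of \<open>L\<close> that carries one side to the other repairs the
  relation when the first dilation is multiplied by \<open>G\<close> on the left and the second by \<open>G\<^sup>-\<^sup>1\<close> on
  the right.

  For tuples, \<open>G\<close> has to intertwine the products \<open>A\<^sub>i B\<^sub>j\<close> with the combinations
  \<open>\<Sum> u\<^sub>i\<^sub>j\<^sub>,\<^sub>k\<^sub>l B\<^sub>l A\<^sub>k\<close>, which links its blocks on the levels of \<open>L\<close>.  The maps \<open>A\<^sub>i\<close> and \<open>B\<^sub>j\<close> are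
  chosen as shifts by half a level combined with isometries that satisfy the Cuntz relations with
  full range.  Then each block of \<open>G\<close> determines the next one (\<open>unitary_intertwiner\<close>), and only the
  block at level \<open>0\<close> has to be found.  It must carry one family of vectors to another one with the
  same Gram matrix.  As the defect maps of the two tuples are given separate coordinates, these
  families are orthogonal to each other, and a reflection exchanges them
  (\<open>reflection_swapping_families\<close>).

  The defect map comes from the fact that a positive contraction \<open>F\<close> is the strongly convergent sum of
  the squares of the operators \<open>\<phi>\<^sub>0 = F\<close>, \<open>\<phi>\<^sub>k\<^sub>+\<^sub>1 = \<phi>\<^sub>k - \<phi>\<^sub>k\<^sup>2\<close>
  (\<open>positive_contraction_factorization\<close>): these operators are the coordinates of a map \<open>\<Delta>\<close> to a
  direct sum of copies of \<open>H\<close> with \<open>\<Delta>\<^sup>*\<Delta> = F\<close>, which serves as a square root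
  (\<open>row_contraction_defect\<close>).
\<close>

section \<open>Sesquilinear algebra\<close>

lemma cinner_zero_left [simp]: "cinner 0 (y::'a::complex_inner) = 0"
  using cinner_add_left[of 0 0 y] by simp

lemma cinner_zero_right [simp]: "cinner (x::'a::complex_inner) 0 = 0"
  using cinner_add_right[of x 0 0] by simp

lemma scaleC_zero_left [simp]: "0 *\<^sub>C (x::'a::complex_inner) = 0"
  using scaleC_add_left[of 0 0 x] by simp

lemma scaleC_zero_right [simp]: "a *\<^sub>C (0::'a::complex_inner) = 0"
  using scaleC_add_right[of a 0 0] by simp

lemma scaleC_minus_one: "(-1) *\<^sub>C (x::'a::complex_inner) = - x"
  using scaleC_add_left[of 1 "-1" x] by (simp add: scaleC_one minus_unique)

lemma scaleC_minus_right: "a *\<^sub>C (- x) = - (a *\<^sub>C (x::'a::complex_inner))"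
  using scaleC_add_right[of a x "- x"] by (simp add: minus_unique)

lemma scaleC_diff_right: "a *\<^sub>C (x - y) = a *\<^sub>C x - a *\<^sub>C (y::'a::complex_inner)"
  using scaleC_add_right[of a x "- y"] by (simp add: scaleC_minus_right)

lemma scaleC_sum_right: "a *\<^sub>C (\<Sum>i\<in>I. f i) = (\<Sum>i\<in>I. a *\<^sub>C (f i :: 'a::complex_inner))"
  by (induction I rule: infinite_finite_induct) (auto simp: scaleC_add_right)

lemma scaleC_sum_left: "(\<Sum>i\<in>I. a i) *\<^sub>C x = (\<Sum>i\<in>I. a i *\<^sub>C (x :: 'a::complex_inner))"
  by (induction I rule: infinite_finite_induct) (auto simp: scaleC_add_left)

lemma cinner_minus_left: "cinner (- x) y = - cinner x (y::'a::complex_inner)"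
  using cinner_add_left[of x "- x" y] by (simp add: minus_unique)

lemma cinner_minus_right: "cinner x (- y) = - cinner x (y::'a::complex_inner)"
  using cinner_add_right[of x y "- y"] by (simp add: minus_unique)

lemma cinner_diff_left: "cinner (x - y) z = cinner x z - cinner y (z::'a::complex_inner)"
  using cinner_add_left[of x "- y" z] by (simp add: cinner_minus_left)

lemma cinner_diff_right: "cinner x (y - z) = cinner x y - cinner x (z::'a::complex_inner)"
  using cinner_add_right[of x y "- z"] by (simp add: cinner_minus_right)

lemma cinner_sum_left: "cinner (\<Sum>i\<in>I. f i) y = (\<Sum>i\<in>I. cinner (f i) (y::'a::complex_inner))"
  by (induction I rule: infinite_finite_induct) (auto simp: cinner_add_left)

lemma cinner_sum_right: "cinner x (\<Sum>i\<in>I. f i) = (\<Sum>i\<in>I. cinner x (f i :: 'a::complex_inner))"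
  by (induction I rule: infinite_finite_induct) (auto simp: cinner_add_right)

lemma cinner_eq_zero_iff: "cinner x x = 0 \<longleftrightarrow> x = (0::'a::complex_inner)"
  by (simp add: cinner_self)

lemma cinner_eqI: "(\<And>z. cinner x z = cinner y z) \<Longrightarrow> x = (y::'a::complex_inner)"
  using cinner_eq_zero_iff[of "x - y"] by (simp add: cinner_diff_left)

lemma cinner_eqI_right: "(\<And>z. cinner z x = cinner z y) \<Longrightarrow> x = (y::'a::complex_inner)"
  by (rule cinner_eqI) (metis cinner_commute)

text \<open>The imaginary part of \<open>cinner x y\<close> is the real part for \<open>-\<i> x\<close>, so
  \<open>inner\<close> and the complex structure determine the complex inner product.\<close>

lemma cinner_eq_inner: "cinner x y = Complex (inner x y) (- inner (\<i> *\<^sub>C x) (y::'a::complex_inner))"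
  by (simp add: inner_cinner cinner_scaleC_left complex_eq_iff)

text \<open>Rotating \<open>x\<close> by a phase makes the inner product real and nonnegative, which reduces the complex
  Cauchy--Schwarz inequality to the real one.\<close>

lemma norm_cinner_le_norm: "norm (cinner x y) \<le> norm x * norm (y::'a::complex_inner)"
proof (cases "cinner x y = 0")
  case False
  define a where "a = cnj (cinner x y) / norm (cinner x y)"
  have a: "norm a = 1" using False by (simp add: a_def norm_divide)
  have "a * cinner x y = complex_of_real ((norm (cinner x y))\<^sup>2) / norm (cinner x y)"
    unfolding complex_norm_square by (simp add: a_def mult.commute)
  then have "cinner (a *\<^sub>C x) y = complex_of_real (norm (cinner x y))"
    using False by (simp add: cinner_scaleC_left power2_eq_square)
  then have "norm (cinner x y) = Re (cinner (a *\<^sub>C x) y)" by simp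
  also have "\<dots> \<le> norm (a *\<^sub>C x) * norm y"
    by (simp only: inner_cinner[symmetric] norm_cauchy_schwarz)
  finally show ?thesis by (simp add: norm_scaleC a)
qed simp

lemma tendsto_cinner_left:
  fixes y :: "'a::complex_inner"
  assumes "(f \<longlongrightarrow> x) F" shows "((\<lambda>t. cinner (f t) y) \<longlongrightarrow> cinner x y) F"
proof (rule Lim_null_comparison[THEN LIM_zero_cancel])
  show "\<forall>\<^sub>F t in F. norm (cinner (f t) y - cinner x y) \<le> norm (f t - x) * norm y"
    by (simp add: cinner_diff_left[symmetric] norm_cinner_le_norm)
  show "((\<lambda>t. norm (f t - x) * norm y) \<longlongrightarrow> 0) F"
    using assms by (intro tendsto_mult_left_zero) (simp add: LIM_zero tendsto_norm_zero)
qed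

lemma clinear_on_UNIV_iff:
  "clinear_on UNIV f \<longleftrightarrow> (\<forall>x y. f (x + y) = f x + f y) \<and> (\<forall>a x. f (a *\<^sub>C x) = a *\<^sub>C f x)"
  by (auto simp: clinear_on_def)

lemma clinear_onI:
  "(\<And>x y. f (x + y) = f x + f y) \<Longrightarrow> (\<And>a x. f (a *\<^sub>C x) = a *\<^sub>C f x) \<Longrightarrow> clinear_on UNIV f"
  by (simp add: clinear_on_UNIV_iff)

lemma clinear_add: "clinear_on UNIV f \<Longrightarrow> f (x + y) = f x + f y"
  and clinear_scaleC: "clinear_on UNIV f \<Longrightarrow> f (a *\<^sub>C x) = a *\<^sub>C f x"
  by (auto simp: clinear_on_UNIV_iff)

lemma clinear_zero: "clinear_on UNIV f \<Longrightarrow> f 0 = 0"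
  using clinear_scaleC[of f 0 0] by simp

lemma clinear_minus: "clinear_on UNIV f \<Longrightarrow> f (- x) = - f x"
  using clinear_scaleC[of f "-1" x] by (simp add: scaleC_minus_one)

lemma clinear_diff: "clinear_on UNIV f \<Longrightarrow> f (x - y) = f x - f y"
  using clinear_add[of f x "- y"] by (simp add: clinear_minus)

lemma clinear_sum: "clinear_on UNIV f \<Longrightarrow> f (\<Sum>i\<in>I. g i) = (\<Sum>i\<in>I. f (g i))"
  by (induction I rule: infinite_finite_induct) (auto simp: clinear_zero clinear_add)

lemma clinear_compose: "clinear_on UNIV f \<Longrightarrow> clinear_on UNIV g \<Longrightarrow> clinear_on UNIV (\<lambda>x. f (g x))"
  by (simp add: clinear_on_UNIV_iff)

lemma clinear_plus:
  "clinear_on UNIV f \<Longrightarrow> clinear_on UNIV g \<Longrightarrow> clinear_on UNIV (\<lambda>x. f x + g x)"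
  by (simp add: clinear_on_UNIV_iff scaleC_add_right)

lemma clinear_minus_fun:
  "clinear_on UNIV f \<Longrightarrow> clinear_on UNIV g \<Longrightarrow> clinear_on UNIV (\<lambda>x. f x - g x)"
  by (simp add: clinear_on_UNIV_iff scaleC_diff_right)

lemma clinear_sum_fun:
  "(\<And>i. i \<in> I \<Longrightarrow> clinear_on UNIV (f i)) \<Longrightarrow> clinear_on UNIV (\<lambda>x. \<Sum>i\<in>I. f i x)"
  by (simp add: clinear_on_UNIV_iff scaleC_sum_right sum.distrib)

lemma clinear_scaleC_fun: "clinear_on UNIV f \<Longrightarrow> clinear_on UNIV (\<lambda>x. c *\<^sub>C f x)"
  by (simp add: clinear_on_UNIV_iff scaleC_add_right scaleC_scaleC mult.commute)

lemma clinear_id: "clinear_on UNIV (\<lambda>x. x)"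
  by (simp add: clinear_on_UNIV_iff)

text \<open>Polarization: both \<open>inner\<close> and multiplication by \<open>\<i>\<close> are determined by norms and linearity.\<close>

lemma isometry_cinner:
  assumes "isometry_on UNIV V"
  shows "cinner (V x) (V y) = cinner x (y :: 'a::complex_inner)"
proof -
  have lin: "clinear_on UNIV V" and nrm: "\<And>x. norm (V x) = norm x"
    using assms by (auto simp: isometry_on_def)
  have re: "inner (V x) (V y) = inner x y" for x y
    using nrm[of "x + y"] nrm[of x] nrm[of y]
    by (simp add: norm_eq_sqrt_inner clinear_add[OF lin] inner_add_left inner_add_right
        inner_commute)
  show ?thesis
    unfolding cinner_eq_inner by (simp add: re clinear_scaleC[OF lin, symmetric])
qed

lemma isometryI:
  assumes "clinear_on UNIV V" "\<And>x. cinner (V x) (V x) = cinner x x"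
  shows "isometry_on UNIV V"
proof -
  have "norm (V x) = norm x" for x
    using assms(2)[of x] by (simp add: cinner_self flip: of_real_power)
  then show ?thesis using assms(1) by (simp add: isometry_on_def)
qed

section \<open>Orthogonal projections and adjoints\<close>

text \<open>The classical minimization argument.  By the parallelogram law a sequence in \<open>M\<close> that minimizes the
  distance to \<open>x\<close> is Cauchy, and the variation of the squared distance at its limit \<open>y\<close>
  in a direction \<open>z\<close> of \<open>M\<close> vanishes only if \<open>x - y\<close> is orthogonal to \<open>z\<close>.\<close>

lemma orthogonal_projection_exists:
  fixes M :: "'a::complex_hilbert set"
  assumes M: "closed_csubspace M"
  shows "\<exists>y\<in>M. \<forall>z\<in>M. cinner (x - y) z = 0"
proof -
  have cl: "closed M" and M0: "0 \<in> M" and Madd: "\<And>x y. x \<in> M \<Longrightarrow> y \<in> M \<Longrightarrow> x + y \<in> M"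
    and Msc: "\<And>a x. x \<in> M \<Longrightarrow> a *\<^sub>C x \<in> M"
    using M by (auto simp: closed_csubspace_def)
  define d where "d = Inf ((\<lambda>y. (norm (x - y))\<^sup>2) ` M)"
  have bdd: "bdd_below ((\<lambda>y. (norm (x - y))\<^sup>2) ` M)"
    by (rule bdd_belowI2[of _ 0]) simp
  have d_le: "d \<le> (norm (x - y))\<^sup>2" if "y \<in> M" for y
    unfolding d_def using that bdd by (intro cInf_lower) auto
  have "\<exists>y\<in>M. (norm (x - y))\<^sup>2 < d + 1 / real (Suc k)" for k
    using cInf_lessD[of "(\<lambda>y. (norm (x - y))\<^sup>2) ` M" "d + 1 / real (Suc k)"] M0
    by (auto simp: d_def)
  then obtain s where s: "\<And>k. s k \<in> M" "\<And>k. (norm (x - s k))\<^sup>2 < d + 1 / real (Suc k)"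
    by metis
  have half: "(1/2) *\<^sub>R (a + b) \<in> M" if "a \<in> M" "b \<in> M" for a b
    using Msc[OF Madd[OF that], of "complex_of_real (1/2)"] by (simp only: scaleR_scaleC)
  have close: "(norm (a - b))\<^sup>2 \<le> 2 * (norm (x - a))\<^sup>2 + 2 * (norm (x - b))\<^sup>2 - 4 * d"
    if "a \<in> M" "b \<in> M" for a b
  proof -
    have "(norm (a - b))\<^sup>2 = 2 * (norm (x - a))\<^sup>2 + 2 * (norm (x - b))\<^sup>2
        - 4 * (norm (x - (1/2) *\<^sub>R (a + b)))\<^sup>2"
      by (simp add: power2_norm_eq_inner algebra_simps inner_commute)
    with d_le[OF half[OF that]] show ?thesis by linarith
  qed
  have "Cauchy s"
  proof (rule metric_CauchyI)
    fix e :: real assume "0 < e"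
    then obtain N where N: "1 / real (Suc N) < e\<^sup>2 / 4"
      using reals_Archimedean[of "e\<^sup>2 / 4"] by (auto simp: inverse_eq_divide)
    have "dist (s k) (s l) < e" if "k \<ge> N" "l \<ge> N" for k l
    proof -
      have "1 / real (Suc k) \<le> 1 / real (Suc N)" "1 / real (Suc l) \<le> 1 / real (Suc N)"
        using that by (auto intro!: divide_left_mono)
      then have "(norm (s k - s l))\<^sup>2 < e\<^sup>2"
        using close[OF s(1) s(1), of k l] s(2)[of k] s(2)[of l] N by linarith
      then show ?thesis
        using \<open>0 < e\<close> by (simp add: dist_norm power2_less_imp_less)
    qed
    then show "\<exists>N. \<forall>k\<ge>N. \<forall>l\<ge>N. dist (s k) (s l) < e" by blast
  qed
  then obtain y where y: "s \<longlonglongrightarrow> y"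
    using Cauchy_convergent convergent_def by blast
  have yM: "y \<in> M" using closed_sequentially[OF cl _ y] s(1) by blast
  have "(norm (x - y))\<^sup>2 \<le> d + 0"
  proof (rule LIMSEQ_le)
    show "(\<lambda>k. (norm (x - s k))\<^sup>2) \<longlonglongrightarrow> (norm (x - y))\<^sup>2" by (intro tendsto_intros y)
    show "(\<lambda>k. d + 1 / real (Suc k)) \<longlonglongrightarrow> d + 0"
      using LIMSEQ_inverse_real_of_nat by (intro tendsto_intros) (simp add: inverse_eq_divide)
    show "\<exists>N. \<forall>k\<ge>N. (norm (x - s k))\<^sup>2 \<le> d + 1 / real (Suc k)" using s(2) less_imp_le by blast
  qed
  then have min: "(norm (x - y))\<^sup>2 \<le> (norm (x - y - z))\<^sup>2" if "z \<in> M" for z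
    using d_le[OF Madd[OF yM that]] unfolding diff_diff_eq by linarith
  have inner0: "inner (x - y) z = 0" if z: "z \<in> M" for z
  proof -
    have "2 * t * inner (x - y) z \<le> t\<^sup>2 * (norm z)\<^sup>2" for t
    proof -
      have "t *\<^sub>R z \<in> M" using Msc[OF z] by (simp add: scaleR_scaleC)
      moreover have "(norm (v - t *\<^sub>R z))\<^sup>2 = (norm v)\<^sup>2 - 2 * t * inner v z + t\<^sup>2 * (norm z)\<^sup>2" for v
        by (simp add: power2_norm_eq_inner inner_diff_left inner_diff_right inner_commute
            power2_eq_square[of t] algebra_simps)
      ultimately show ?thesis using min[of "t *\<^sub>R z"] by simp
    qed
    note t = this
    show ?thesis
    proof (cases "z = 0")
      case False
      define c N where "c = inner (x - y) z" and "N = (norm z)\<^sup>2"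
      have "N > 0" using False by (simp add: N_def)
      \<comment> \<open>The multiple \<open>c / N\<close> of \<open>z\<close> minimizes the distance along the line of \<open>z\<close>.\<close>
      have "2 * (c / N) * c \<le> (c / N)\<^sup>2 * N"
        using t[of "c / N"] by (simp only: c_def N_def)
      then have "c\<^sup>2 \<le> 0" using \<open>N > 0\<close> by (simp add: field_simps power2_eq_square)
      then show ?thesis by (simp add: c_def)
    qed simp
  qed
  have "cinner (x - y) z = 0" if "z \<in> M" for z
  proof -
    have "inner (x - y) (\<i> *\<^sub>C z) = 0" using inner0[OF Msc[OF that]] .
    then have "Im (cinner (x - y) z) = 0" by (simp add: inner_cinner cinner_scaleC_right)
    moreover have "Re (cinner (x - y) z) = 0" using inner0[OF that] by (simp add: inner_cinner)
    ultimately show ?thesis by (simp add: complex_eq_iff)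
  qed
  with yM show ?thesis by blast
qed

lemma closed_csubspace_orthogonal: "closed_csubspace {x::'a::complex_inner. \<forall>s\<in>S. cinner x s = 0}"
proof -
  have "closed {x::'a. cinner x s = 0}" for s
    unfolding closed_sequential_limits
  proof clarsimp
    fix X :: "nat \<Rightarrow> 'a" and l assume "\<forall>n. cinner (X n) s = 0" "X \<longlonglongrightarrow> l"
    then show "cinner l s = 0"
      using LIMSEQ_unique[OF tendsto_cinner_left, of X l s 0] by simp
  qed
  then have "closed (\<Inter>s\<in>S. {x::'a. cinner x s = 0})" by blast
  moreover have "{x::'a. \<forall>s\<in>S. cinner x s = 0} = (\<Inter>s\<in>S. {x. cinner x s = 0})" by auto
  ultimately show ?thesis
    by (auto simp: closed_csubspace_def cinner_add_left cinner_scaleC_left)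
qed

text \<open>If \<open>f\<close> is not zero, its kernel is a proper closed subspace, and a vector orthogonal to the kernel
  represents \<open>f\<close> up to a scalar.\<close>

lemma riesz_representation:
  fixes f :: "'a::complex_hilbert \<Rightarrow> complex"
  assumes lin: "clinear_on UNIV f" and bdd: "\<And>x. norm (f x) \<le> c * norm x"
  shows "\<exists>z. \<forall>x. f x = cinner x z"
proof (cases "\<forall>x. f x = 0")
  case True
  then show ?thesis by (intro exI[of _ 0]) simp
next
  case False
  then obtain x0 where x0: "f x0 \<noteq> 0" by blast
  have "closed {x. f x = 0}"
    unfolding closed_sequential_limits
  proof clarsimp
    fix X l assume X: "\<forall>n. f (X n) = 0" "X \<longlonglongrightarrow> l"
    have "(\<lambda>n. f (X n)) \<longlonglongrightarrow> f l"
    proof (rule Lim_null_comparison[THEN LIM_zero_cancel])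
      show "\<forall>\<^sub>F n in sequentially. norm (f (X n) - f l) \<le> c * norm (X n - l)"
        using bdd by (simp add: clinear_diff[OF lin, symmetric])
      show "(\<lambda>n. c * norm (X n - l)) \<longlonglongrightarrow> 0"
        using X(2) by (intro tendsto_mult_right_zero) (simp add: LIM_zero tendsto_norm_zero)
    qed
    with X(1) show "f l = 0" by (simp add: LIMSEQ_const_iff)
  qed
  then have "closed_csubspace {x. f x = 0}"
    by (auto simp: closed_csubspace_def clinear_add[OF lin] clinear_scaleC[OF lin] clinear_zero[OF lin])
  then obtain y where y: "f y = 0" "\<And>z. f z = 0 \<Longrightarrow> cinner (x0 - y) z = 0"
    using orthogonal_projection_exists[of "{x. f x = 0}" x0] by blast
  define w where "w = x0 - y"
  have fw: "f w = f x0" by (simp add: w_def clinear_diff[OF lin] y)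
  then have "w \<noteq> 0" using x0 clinear_zero[OF lin] by auto
  then have ww: "cinner w w \<noteq> 0" by (simp add: cinner_eq_zero_iff)
  show ?thesis
  proof (intro exI allI)
    fix x
    have "f (f w *\<^sub>C x - f x *\<^sub>C w) = 0"
      by (simp add: clinear_diff[OF lin] clinear_scaleC[OF lin] scaleC_complex_def)
    then have "cinner (f w *\<^sub>C x - f x *\<^sub>C w) w = 0"
      using y(2) cinner_commute[of _ w] by (simp add: w_def)
    then have "f w * cinner x w = f x * cinner w w"
      by (simp add: cinner_diff_left cinner_scaleC_left)
    then show "f x = cinner x (cnj (f w / cinner w w) *\<^sub>C w)"
      using ww by (simp add: cinner_scaleC_right field_simps)
  qed
qed

text \<open>Riesz representation is what turns the definite description in \<open>adjoint_on\<close> into an actual adjoint.\<close>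

lemma cinner_adjoint:
  fixes A :: "'a::complex_hilbert \<Rightarrow> 'a"
  assumes "bounded_operator_on UNIV A"
  shows "cinner (A x) y = cinner x (adjoint_on UNIV A y)"
proof -
  obtain c where lin: "clinear_on UNIV A" and c: "\<And>x. norm (A x) \<le> c * norm x"
    using assms by (auto simp: bounded_operator_on_def)
  have "norm (cinner (A x) y) \<le> c * norm y * norm x" for x
    using norm_cinner_le_norm[of "A x" y] mult_right_mono[OF c[of x], of "norm y"]
    by (simp add: mult_ac)
  moreover have "clinear_on UNIV (\<lambda>x. cinner (A x) y)"
    using lin by (simp add: clinear_on_UNIV_iff cinner_add_left cinner_scaleC_left scaleC_complex_def)
  ultimately obtain z where z: "\<And>x. cinner (A x) y = cinner x z"
    using riesz_representation[of "\<lambda>x. cinner (A x) y" "c * norm y"] by blast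
  have "adjoint_on UNIV A y = z"
    unfolding adjoint_on_def
    by (rule the_equality) (use z in \<open>auto intro: cinner_eqI_right\<close>)
  with z show ?thesis by simp
qed

lemma cinner_adjoint_left:
  fixes A :: "'a::complex_hilbert \<Rightarrow> 'a"
  assumes "bounded_operator_on UNIV A"
  shows "cinner (adjoint_on UNIV A y) x = cinner y (A x)"
  by (metis assms cinner_adjoint cinner_commute)

lemma clinear_adjoint:
  fixes A :: "'a::complex_hilbert \<Rightarrow> 'a"
  assumes "bounded_operator_on UNIV A"
  shows "clinear_on UNIV (adjoint_on UNIV A)"
  by (rule clinear_onI; rule cinner_eqI)
    (simp_all add: cinner_adjoint_left[OF assms] cinner_add_left cinner_scaleC_left)

section \<open>Unitary operators and reflections\<close>

definition unitary_operator :: "('a::complex_inner \<Rightarrow> 'b::complex_inner) \<Rightarrow> bool" where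
  "unitary_operator G \<longleftrightarrow> isometry_on UNIV G \<and> surj G"

lemma unitary_operator_clinear: "unitary_operator G \<Longrightarrow> clinear_on UNIV G"
  and unitary_operator_norm: "unitary_operator G \<Longrightarrow> norm (G x) = norm x"
  and unitary_operator_isometry: "unitary_operator G \<Longrightarrow> isometry_on UNIV G"
  by (auto simp: unitary_operator_def isometry_on_def)

lemma unitary_operator_inj: assumes "unitary_operator G" shows "inj G"
proof (rule injI)
  fix x y assume "G x = G y"
  then have "norm (x - y) = 0"
    using unitary_operator_norm[OF assms, of "x - y"]
    by (simp add: clinear_diff[OF unitary_operator_clinear[OF assms]])
  then show "x = y" by simp
qed

lemma unitary_operator_inv:
  assumes "unitary_operator G"
  shows "unitary_operator (inv G)" "inv G (G x) = x" "G (inv G y) = y"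
proof -
  have i: "inj G" and s: "surj G" and lin: "clinear_on UNIV G"
    using unitary_operator_inj[OF assms] assms unitary_operator_clinear[OF assms]
    by (auto simp: unitary_operator_def)
  show 1: "inv G (G x) = x" for x using i by simp
  show 2: "G (inv G y) = y" for y using s by (simp add: surj_f_inv_f)
  have "clinear_on UNIV (inv G)"
    by (rule clinear_onI; rule injD[OF i])
      (simp_all add: 2 clinear_add[OF lin] clinear_scaleC[OF lin])
  moreover have "norm (inv G y) = norm y" for y
    using unitary_operator_norm[OF assms, of "inv G y"] by (simp add: 2)
  moreover have "surj (inv G)" using 1 by (metis surjI)
  ultimately show "unitary_operator (inv G)"
    by (simp add: unitary_operator_def isometry_on_def)
qed

lemma unitary_operator_id: "unitary_operator (\<lambda>x. x)"
  by (simp add: unitary_operator_def isometry_on_def clinear_id surj_def)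

text \<open>Extending the isometry \<open>M p \<mapsto> N p\<close> to a unitary operator would in general need room: the closed spans
  of the two families may have different codimensions.  When the families are orthogonal to each other,
  the room is already there, and the extension is explicit: the reflection in the orthogonal
  complement of all differences \<open>M p - N p\<close>.  Equality of the Gram matrices says that \<open>M p + N p\<close>
  lies in that complement, so the reflection fixes \<open>M p + N p\<close>, negates \<open>M p - N p\<close>, and hence
  exchanges \<open>M p\<close> with \<open>N p\<close>.\<close>

lemma reflection_swapping_families:
  fixes M N :: "'p \<Rightarrow> 'a::complex_hilbert"
  assumes gram: "\<And>p q. p \<in> I \<Longrightarrow> q \<in> I \<Longrightarrow> cinner (M p) (M q) = cinner (N p) (N q)"
    and orth: "\<And>p q. p \<in> I \<Longrightarrow> q \<in> I \<Longrightarrow> cinner (M p) (N q) = 0"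
  shows "\<exists>R. unitary_operator R \<and> (\<forall>p\<in>I. R (M p) = N p)"
proof -
  define E where "E = {x. \<forall>s\<in>(\<lambda>p. M p - N p) ` I. cinner x s = 0}"
  have E: "closed_csubspace E" unfolding E_def by (rule closed_csubspace_orthogonal)
  then have Eadd: "\<And>x y. x \<in> E \<Longrightarrow> y \<in> E \<Longrightarrow> x + y \<in> E"
    and Esc: "\<And>a x. x \<in> E \<Longrightarrow> a *\<^sub>C x \<in> E"
    by (auto simp: closed_csubspace_def)
  obtain P where P: "\<And>x. P x \<in> E" "\<And>x z. z \<in> E \<Longrightarrow> cinner (x - P x) z = 0"
    using orthogonal_projection_exists[OF E] by metis
  have P_eqI: "P x = y" if "y \<in> E" "\<And>z. z \<in> E \<Longrightarrow> cinner (x - y) z = 0" for x y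
  proof -
    have "y - P x \<in> E" using Eadd[OF that(1) Esc[OF P(1), of "-1" x]] by (simp add: scaleC_minus_one)
    then have "cinner (x - P x) (y - P x) - cinner (x - y) (y - P x) = 0"
      using P(2) that(2) by simp
    then have "cinner (y - P x) (y - P x) = 0" by (simp add: cinner_diff_left)
    then show ?thesis by (simp add: cinner_eq_zero_iff)
  qed
  have linP: "clinear_on UNIV P"
  proof (rule clinear_onI)
    fix x y :: 'a and a :: complex
    have "cinner (x + y - (P x + P y)) z = cinner (x - P x) z + cinner (y - P y) z" for z
      by (simp add: cinner_add_left cinner_diff_left)
    then show "P (x + y) = P x + P y" using P Eadd by (intro P_eqI) auto
    have "cinner (a *\<^sub>C x - a *\<^sub>C P x) z = a * cinner (x - P x) z" for z
      by (simp add: cinner_scaleC_left flip: scaleC_diff_right)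
    then show "P (a *\<^sub>C x) = a *\<^sub>C P x" using P Esc by (intro P_eqI) auto
  qed
  define R where "R x = P x - (x - P x)" for x
  have linR: "clinear_on UNIV R"
    unfolding R_def by (intro clinear_minus_fun linP clinear_id)
  have PP: "P (P x) = P x" for x by (rule P_eqI) (auto simp: P)
  have RR: "R (R x) = x" for x
    unfolding R_def by (simp add: clinear_diff[OF linP] PP)
  have iso: "isometry_on UNIV R"
  proof (rule isometryI[OF linR])
    fix x
    have "cinner (x - P x) (P x) = 0" using P by blast
    moreover from this have "cinner (P x) (x - P x) = 0" by (metis cinner_commute complex_cnj_zero)
    ultimately have "cinner (R x) (R x) = cinner (P x + (x - P x)) (P x + (x - P x))"
      unfolding R_def
      by (simp only: cinner_diff_left[of "P x"] cinner_diff_right[of _ "P x"] cinner_add_left cinner_add_right) simp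
    then show "cinner (R x) (R x) = cinner x x" by simp
  qed
  have "R (M p) = N p" if p: "p \<in> I" for p
  proof -
    have sym: "cinner (N p) (M q) = 0" if "q \<in> I" for q
      using orth[OF that p] by (metis cinner_commute complex_cnj_zero)
    have "M p + N p \<in> E"
      unfolding E_def using p by (auto simp: cinner_add_left cinner_diff_right gram orth sym)
    then have mid: "(1/2) *\<^sub>C (M p + N p) \<in> E" by (rule Esc)
    have half: "M p - (1/2) *\<^sub>C (M p + N p) = (1/2) *\<^sub>C (M p - N p)"
    proof -
      have "M p = (1/2) *\<^sub>C M p + (1/2) *\<^sub>C M p"
        using scaleC_add_left[of "1/2" "1/2" "M p"] by (simp add: scaleC_one)
      then show ?thesis by (simp add: scaleC_add_right scaleC_diff_right algebra_simps)
    qed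
    have "cinner (M p - (1/2) *\<^sub>C (M p + N p)) z = 0" if "z \<in> E" for z
    proof -
      have "cinner z (M p - N p) = 0" using that p by (auto simp: E_def)
      then show ?thesis
        unfolding half by (metis cinner_commute cinner_scaleC_left complex_cnj_zero mult_zero_right)
    qed
    then have "P (M p) = (1/2) *\<^sub>C (M p + N p)" by (rule P_eqI[OF mid])
    then have "R (M p) = (1/2) *\<^sub>C (M p + N p) - (1/2) *\<^sub>C (M p - N p)"
      unfolding R_def by (simp only: half)
    also have "\<dots> = (1/2) *\<^sub>C N p + (1/2) *\<^sub>C N p" by (simp add: scaleC_add_right scaleC_diff_right)
    also have "\<dots> = N p" by (simp add: scaleC_one flip: scaleC_add_left)
    finally show ?thesis .
  qed
  moreover have "surj R" using RR by (metis surjI)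
  ultimately show ?thesis using iso unfolding unitary_operator_def by blast
qed

section \<open>Coordinate operations on square-summable families\<close>

lemma ell2_eqI: "(\<And>i. ell2_nth x i = ell2_nth y i) \<Longrightarrow> x = y"
  by (simp add: ell2_nth_inject[symmetric] fun_eq_iff)

lemma ell2_nth_add [simp]: "ell2_nth (x + y) i = ell2_nth x i + ell2_nth y i"
  and ell2_nth_diff [simp]: "ell2_nth (x - y) i = ell2_nth x i - ell2_nth y i"
  and ell2_nth_scaleC [simp]: "ell2_nth (a *\<^sub>C x) i = a *\<^sub>C ell2_nth x i"
  and ell2_nth_zero [simp]: "ell2_nth 0 i = 0"
  by (transfer; simp)+

lemma ell2_nth_sum: "ell2_nth (\<Sum>k\<in>I. f k) i = (\<Sum>k\<in>I. ell2_nth (f k) i)"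
  by (induction I rule: infinite_finite_induct) auto

lemma clinear_ell2_nth: "clinear_on UNIV (\<lambda>x. ell2_nth x i)"
  by (simp add: clinear_on_UNIV_iff)

lift_definition single :: "'i \<Rightarrow> 'a \<Rightarrow> ('i, 'a::complex_inner) ell2"
  is "\<lambda>i h j. if j = i then h else 0"
proof -
  fix i :: 'i and h :: 'a
  have "(\<lambda>j. (norm (if j = i then h else 0))\<^sup>2) summable_on UNIV \<longleftrightarrow>
      (\<lambda>j. (norm (if j = i then h else 0))\<^sup>2) summable_on {i}"
    by (rule summable_on_cong_neutral) auto
  then show "(\<lambda>j. (norm (if j = i then h else 0))\<^sup>2) summable_on UNIV" by simp
qed

lemma ell2_nth_single: "ell2_nth (single i h) j = (if j = i then h else 0)"
  by transfer simp

lemma clinear_single: "clinear_on UNIV (single i)"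
  by (rule clinear_onI; rule ell2_eqI) (auto simp: ell2_nth_single)

lemma cinner_single_right: "cinner x (single i h) = cinner (ell2_nth x i) h"
proof -
  have "cinner x (single i h) = (\<Sum>\<^sub>\<infinity>j\<in>{i}. cinner (ell2_nth x j) (ell2_nth (single i h) j))"
    unfolding cinner_ell2_def by (rule infsum_cong_neutral) (auto simp: ell2_nth_single)
  then show ?thesis by (simp add: ell2_nth_single)
qed

lemma cinner_single_left: "cinner (single i h) x = cinner h (ell2_nth x i)"
  by (metis cinner_single_right cinner_commute)

text \<open>\<open>spread f\<close> moves the coordinate \<open>i\<close> to the position \<open>f i\<close> and fills the other positions with zeros;
  for injective \<open>f\<close> it is an isometry with adjoint \<open>gather f\<close>, which reads the coordinates back.
  All shift-like isometries of the construction are of this form, so their relations become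
  relations between maps of indices.\<close>

lift_definition spread :: "('i \<Rightarrow> 'j) \<Rightarrow> ('i, 'a::complex_inner) ell2 \<Rightarrow> ('j, 'a) ell2"
  is "\<lambda>f x j. if j \<in> range f then x (inv f j) else 0"
proof -
  fix f :: "'i \<Rightarrow> 'j" and x :: "'i \<Rightarrow> 'a"
  assume x: "(\<lambda>i. (norm (x i))\<^sup>2) summable_on UNIV"
  have "((\<lambda>i. (norm (x i))\<^sup>2) \<circ> inv f) summable_on range f"
    using summable_on_reindex[OF inj_on_inv_into[of "range f" f UNIV], of "\<lambda>i. (norm (x i))\<^sup>2"]
      summable_on_subset_banach[OF x] by simp
  moreover have "((\<lambda>i. (norm (x i))\<^sup>2) \<circ> inv f) summable_on range f \<longleftrightarrow>
      (\<lambda>j. (norm (if j \<in> range f then x (inv f j) else 0))\<^sup>2) summable_on UNIV"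
    by (rule summable_on_cong_neutral) auto
  ultimately show "(\<lambda>j. (norm (if j \<in> range f then x (inv f j) else 0))\<^sup>2) summable_on UNIV"
    by simp
qed

text \<open>The value for \<open>f\<close> that is not injective is a default: repeating a coordinate infinitely often
  would leave the space of square-summable families.\<close>

lift_definition gather :: "('i \<Rightarrow> 'j) \<Rightarrow> ('j, 'a::complex_inner) ell2 \<Rightarrow> ('i, 'a) ell2"
  is "\<lambda>f x i. if inj f then x (f i) else 0"
proof -
  fix f :: "'i \<Rightarrow> 'j" and x :: "'j \<Rightarrow> 'a"
  assume x: "(\<lambda>i. (norm (x i))\<^sup>2) summable_on UNIV"
  show "(\<lambda>i. (norm (if inj f then x (f i) else 0))\<^sup>2) summable_on UNIV"
    using summable_on_reindex[of f UNIV "\<lambda>i. (norm (x i))\<^sup>2"] summable_on_subset_banach[OF x]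
    by (cases "inj f") (simp_all add: comp_def)
qed

lemma ell2_nth_spread: "inj f \<Longrightarrow> ell2_nth (spread f x) (f i) = ell2_nth x i"
  by transfer simp

lemma ell2_nth_spread_outside: "j \<notin> range f \<Longrightarrow> ell2_nth (spread f x) j = 0"
  by transfer simp

lemma ell2_nth_gather: "inj f \<Longrightarrow> ell2_nth (gather f x) i = ell2_nth x (f i)"
  by transfer simp

lemma clinear_spread: "clinear_on UNIV (spread f)"
  by (rule clinear_onI; transfer) auto

lemma clinear_gather: "clinear_on UNIV (gather f)"
  by (rule clinear_onI; transfer) auto

lemma cinner_spread_left:
  assumes "inj f" shows "cinner (spread f x) z = cinner x (gather f z)"
proof -
  have "cinner (spread f x) z = (\<Sum>\<^sub>\<infinity>j\<in>range f. cinner (ell2_nth (spread f x) j) (ell2_nth z j))"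
    unfolding cinner_ell2_def by (rule infsum_cong_neutral) (auto simp: ell2_nth_spread_outside)
  then show ?thesis
    unfolding cinner_ell2_def
    by (simp add: infsum_reindex assms comp_def ell2_nth_spread ell2_nth_gather)
qed

lemma gather_spread: "inj f \<Longrightarrow> gather f (spread f x) = x"
  by (rule ell2_eqI) (simp add: ell2_nth_gather ell2_nth_spread)

lemma gather_spread_disjoint:
  "inj f \<Longrightarrow> (\<And>i j. f i \<noteq> g j) \<Longrightarrow> gather f (spread g x) = 0"
  by (rule ell2_eqI) (auto simp: ell2_nth_gather intro!: ell2_nth_spread_outside)

lemma cinner_spread: "inj f \<Longrightarrow> cinner (spread f x) (spread f y) = cinner x y"
  by (simp add: cinner_spread_left gather_spread)

lemma cinner_spread_disjoint:
  "inj f \<Longrightarrow> (\<And>i j. f i \<noteq> g j) \<Longrightarrow> cinner (spread f x) (spread g y) = 0"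
  by (simp add: cinner_spread_left gather_spread_disjoint)

lemma spread_spread:
  assumes "inj f" "inj g" shows "spread f (spread g x) = spread (\<lambda>i. f (g i)) x"
proof (rule ell2_eqI)
  fix j
  have fg: "inj (\<lambda>i. f (g i))" using assms by (simp add: inj_on_def)
  show "ell2_nth (spread f (spread g x)) j = ell2_nth (spread (\<lambda>i. f (g i)) x) j"
  proof (cases "j \<in> range f")
    case True
    then obtain k where k: "j = f k" by blast
    show ?thesis
    proof (cases "k \<in> range g")
      case True
      then obtain i where "k = g i" by blast
      with k show ?thesis
        using ell2_nth_spread[OF fg, of x i] by (simp add: ell2_nth_spread assms)
    next
      case False
      then have "j \<notin> range (\<lambda>i. f (g i))" using k assms(1) by (auto dest: injD)
      with False k show ?thesis by (simp add: ell2_nth_spread assms ell2_nth_spread_outside)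
    qed
  next
    case False
    then have "j \<notin> range (\<lambda>i. f (g i))" by auto
    with False show ?thesis by (simp add: ell2_nth_spread_outside)
  qed
qed

section \<open>The defect of a row contraction\<close>

text \<open>A quadratic form that is a convergent sum of squares of linear maps is the square of the single
  map whose coordinates are these maps.\<close>

lemma ell2_of_square_sums:
  fixes \<phi> :: "nat \<Rightarrow> 'a::complex_inner \<Rightarrow> 'b::complex_inner"
  assumes lin: "\<And>k. clinear_on UNIV (\<phi> k)"
    and lim: "\<And>x y. (\<lambda>N. \<Sum>k<N. cinner (\<phi> k x) (\<phi> k y)) \<longlonglongrightarrow> B x y"
  shows "\<exists>\<Delta> :: 'a \<Rightarrow> (nat, 'b) ell2. clinear_on UNIV \<Delta> \<and> (\<forall>x y. cinner (\<Delta> x) (\<Delta> y) = B x y)"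
proof -
  have summ: "(\<lambda>k. (norm (\<phi> k x))\<^sup>2) summable_on UNIV" for x
  proof -
    have "(\<lambda>N. Re (\<Sum>k<N. cinner (\<phi> k x) (\<phi> k x))) \<longlonglongrightarrow> Re (B x x)"
      by (intro tendsto_intros lim)
    then have "(\<lambda>k. (norm (\<phi> k x))\<^sup>2) sums Re (B x x)"
      by (simp add: sums_def cinner_self)
    then show ?thesis
      using sums_summable by (subst summable_on_UNIV_nonneg_real_iff) auto
  qed
  define \<Delta> :: "'a \<Rightarrow> (nat, 'b) ell2" where "\<Delta> x = Abs_ell2 (\<lambda>k. \<phi> k x)" for x
  have nth: "ell2_nth (\<Delta> x) k = \<phi> k x" for x k
    unfolding \<Delta>_def using summ[of x] by (simp add: Abs_ell2_inverse)
  have "cinner (\<Delta> x) (\<Delta> y) = B x y" for x y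
  proof -
    have "(\<lambda>k. cinner (ell2_nth (\<Delta> x) k) (ell2_nth (\<Delta> y) k)) sums cinner (\<Delta> x) (\<Delta> y)"
      unfolding cinner_ell2_def by (intro has_sum_imp_sums has_sum_infsum summable_cinner)
    then show ?thesis
      using lim[of x y] LIMSEQ_unique by (auto simp: sums_def nth)
  qed
  moreover have "clinear_on UNIV \<Delta>"
    by (rule clinear_onI; rule ell2_eqI) (simp_all add: nth clinear_add[OF lin] clinear_scaleC[OF lin])
  ultimately show ?thesis by blast
qed

definition positive_contraction :: "('a::complex_inner \<Rightarrow> 'a) \<Rightarrow> bool" where
  "positive_contraction F \<longleftrightarrow> clinear_on UNIV F \<and> (\<forall>x y. cinner (F x) y = cinner x (F y)) \<and>
     (\<forall>x. 0 \<le> inner (F x) x \<and> inner (F x) x \<le> inner x x)"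

text \<open>This is the operator form of \<open>0 \<le> t - t\<^sup>2 \<le> 1\<close> on the unit interval.  Positivity comes from
  \<open>t - t\<^sup>2 = t (1 - t)\<^sup>2 + t\<^sup>2 (1 - t)\<close>, where both summands are manifestly positive for a positive
  contraction.\<close>

lemma positive_contraction_diff_square:
  assumes "positive_contraction F"
  shows "positive_contraction (\<lambda>x. F x - F (F x))"
proof -
  have lin: "clinear_on UNIV F" and sa: "\<And>x y. cinner (F x) y = cinner x (F y)"
    and pos: "\<And>x. 0 \<le> inner (F x) x" and le: "\<And>x. inner (F x) x \<le> inner x x"
    using assms by (auto simp: positive_contraction_def)
  have sa_re: "inner (F x) y = inner x (F y)" for x y
    by (simp add: inner_cinner sa)
  have "0 \<le> inner (F x - F (F x)) x" for x
  proof -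
    have "inner (F x - F (F x)) x =
        inner (F (x - F x)) (x - F x) + (inner (F x) (F x) - inner (F (F x)) (F x))"
      by (simp add: clinear_diff[OF lin] inner_diff_left inner_diff_right sa_re)
    then show ?thesis using pos[of "x - F x"] le[of "F x"] by simp
  qed
  moreover have "inner (F x - F (F x)) x \<le> inner x x" for x
    using le[of x] inner_ge_zero[of "F x"] sa_re[of "F x" x] unfolding inner_diff_left by linarith
  moreover have "clinear_on UNIV (\<lambda>x. F x - F (F x))"
    by (intro clinear_minus_fun clinear_compose[OF lin lin] lin)
  ultimately show ?thesis
    by (simp add: positive_contraction_def cinner_diff_left cinner_diff_right sa)
qed

text \<open>A replacement for the square root, which is needed only up to an isometry and may therefore take
  its values in a larger space.  Put \<open>\<phi>\<^sub>0 = F\<close> and \<open>\<phi>\<^sub>k\<^sub>+\<^sub>1 = \<phi>\<^sub>k - \<phi>\<^sub>k\<^sup>2\<close>.  Then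
  \<open>F = \<phi>\<^sub>0\<^sup>2 + \<dots> + \<phi>\<^sub>N\<^sub>-\<^sub>1\<^sup>2 + \<phi>\<^sub>N\<close> with all \<open>\<phi>\<^sub>k\<close> positive.  The squares \<open>\<parallel>\<phi>\<^sub>k x\<parallel>\<^sup>2\<close> are thus
  summable, so the remainder tends to zero strongly and \<open>F\<close> is the sum of the squares.\<close>

lemma positive_contraction_factorization:
  fixes F :: "'a::complex_inner \<Rightarrow> 'a"
  assumes F: "positive_contraction F"
  shows "\<exists>\<Delta> :: 'a \<Rightarrow> (nat, 'a) ell2. clinear_on UNIV \<Delta> \<and>
    (\<forall>x y. cinner (\<Delta> x) (\<Delta> y) = cinner (F x) y)"
proof -
  define \<phi> where "\<phi> = rec_nat F (\<lambda>_ G x. G x - G (G x))"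
  have \<phi>0: "\<phi> 0 = F" and \<phi>Suc: "\<phi> (Suc k) x = \<phi> k x - \<phi> k (\<phi> k x)" for k x
    by (simp_all add: \<phi>_def)
  have pc: "positive_contraction (\<phi> k)" for k
    by (induction k) (use F in \<open>auto simp: \<phi>0 \<phi>Suc[abs_def] positive_contraction_diff_square\<close>)
  have lin: "clinear_on UNIV (\<phi> k)" and sa: "cinner (\<phi> k x) y = cinner x (\<phi> k y)"
    and pos: "0 \<le> inner (\<phi> k x) x" for k x y
    using pc[of k] by (auto simp: positive_contraction_def)
  have tele: "(\<Sum>k<N. cinner (\<phi> k x) (\<phi> k y)) = cinner (F x) y - cinner (\<phi> N x) y" for N x y
  proof (induction N)
    case (Suc N)
    then show ?case using sa[of N "\<phi> N x" y] by (simp add: \<phi>Suc cinner_diff_left)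
  qed (simp add: \<phi>0)
  have "(\<lambda>N. \<phi> N x) \<longlonglongrightarrow> 0" for x
  proof -
    have "(\<Sum>k<N. (norm (\<phi> k x))\<^sup>2) \<le> inner (F x) x" for N
    proof -
      have "complex_of_real (\<Sum>k<N. (norm (\<phi> k x))\<^sup>2) = cinner (F x) x - cinner (\<phi> N x) x"
        using tele[where x = x and y = x] by (simp add: cinner_self)
      then have "(\<Sum>k<N. (norm (\<phi> k x))\<^sup>2) = inner (F x) x - inner (\<phi> N x) x"
        by (metis Re_complex_of_real inner_cinner minus_complex.simps(1))
      then show ?thesis using pos[of N x] by simp
    qed
    then have "summable (\<lambda>k. (norm (\<phi> k x))\<^sup>2)"
      by (intro summableI_nonneg_bounded) auto
    then have "(\<lambda>k. sqrt ((norm (\<phi> k x))\<^sup>2)) \<longlonglongrightarrow> sqrt 0"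
      by (intro tendsto_real_sqrt summable_LIMSEQ_zero)
    then show ?thesis by (simp add: tendsto_norm_zero_iff)
  qed
  then have "(\<lambda>N. cinner (F x) y - cinner (\<phi> N x) y) \<longlonglongrightarrow> cinner (F x) y - cinner 0 y" for x y
    by (intro tendsto_intros tendsto_cinner_left)
  then show ?thesis
    using ell2_of_square_sums[where \<phi> = \<phi> and B = "\<lambda>x y. cinner (F x) y"] by (simp add: tele lin)
qed

text \<open>The defect operator of the row \<open>T : H\<^sup>I \<rightarrow> H\<close>, that is, a map \<open>D\<close> with \<open>D\<^sup>*D = 1 - T\<^sup>*T\<close>, given by its
  columns.  With \<open>F = 1 - TT\<^sup>*\<close> and \<open>F = \<Delta>\<^sup>*\<Delta>\<close> one may take
  \<open>D h = (h - T\<^sup>*T h, \<Delta> T h)\<close>, because \<open>(1 - T\<^sup>*T)\<^sup>2 + T\<^sup>*(1 - TT\<^sup>*)T = 1 - T\<^sup>*T\<close>.  So it suffices to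
  factor an operator on \<open>H\<close> itself.\<close>

lemma row_contraction_defect:
  fixes T :: "'i \<Rightarrow> 'a::complex_hilbert \<Rightarrow> 'a"
  assumes fin: "finite I"
    and bdd: "\<And>i. i \<in> I \<Longrightarrow> bounded_operator_on UNIV (T i)"
    and row: "row_contraction_on UNIV I T"
  shows "\<exists>D :: 'i \<Rightarrow> 'a \<Rightarrow> ('i + nat, 'a) ell2. \<forall>i\<in>I. clinear_on UNIV (D i) \<and>
    (\<forall>k\<in>I. \<forall>h h'. cinner (D i h) (D k h') =
       (if i = k then cinner h h' else 0) - cinner (T i h) (T k h'))"
proof -
  define T' where "T' i = adjoint_on UNIV (T i)" for i
  have adj: "cinner (T i x) y = cinner x (T' i y)" "cinner (T' i y) x = cinner y (T i x)"
    if "i \<in> I" for i x y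
    using cinner_adjoint[OF bdd[OF that]] cinner_adjoint_left[OF bdd[OF that]] by (auto simp: T'_def)
  have linT: "clinear_on UNIV (T i)" and linT': "clinear_on UNIV (T' i)" if "i \<in> I" for i
    using bdd[OF that] clinear_adjoint[OF bdd[OF that]] by (auto simp: bounded_operator_on_def T'_def)
  define F where "F x = x - (\<Sum>i\<in>I. T i (T' i x))" for x
  have inner_F: "cinner (F x) y = cinner x y - (\<Sum>i\<in>I. cinner (T' i x) (T' i y))" for x y
    by (simp add: F_def cinner_diff_left cinner_sum_left adj)
  have "positive_contraction F"
    unfolding positive_contraction_def
  proof (intro conjI allI)
    show "clinear_on UNIV F"
      unfolding F_def by (intro clinear_minus_fun clinear_id clinear_sum_fun clinear_compose[OF linT linT'])
    show "cinner (F x) y = cinner x (F y)" for x y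
      unfolding inner_F by (simp add: F_def cinner_diff_right cinner_sum_right adj)
    show "0 \<le> inner (F x) x" for x
      using row unfolding row_contraction_on_def op_le_on_def
      by (auto simp: F_def T'_def inner_cinner complex_nonneg_Reals_iff)
    show "inner (F x) x \<le> inner x x" for x
      unfolding inner_cinner inner_F by (simp add: cinner_self sum_nonneg)
  qed
  then obtain \<Delta> :: "'a \<Rightarrow> (nat, 'a) ell2"
    where lin\<Delta>: "clinear_on UNIV \<Delta>" and \<Delta>: "\<And>x y. cinner (\<Delta> x) (\<Delta> y) = cinner (F x) y"
    using positive_contraction_factorization by blast
  define D :: "'i \<Rightarrow> 'a \<Rightarrow> ('i + nat, 'a) ell2" where
    "D i h = (\<Sum>p\<in>I. single (Inl p) ((if p = i then h else 0) - T' p (T i h))) + spread Inr (\<Delta> (T i h))"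
    for i h
  have nth: "ell2_nth (D i h) (Inl p) = (if p = i then h else 0) - T' p (T i h)" if "p \<in> I" for i p h
    using fin that by (simp add: D_def ell2_nth_sum ell2_nth_single ell2_nth_spread_outside image_iff)
  have gth: "gather Inr (D i h) = \<Delta> (T i h)" for i h
    by (rule ell2_eqI) (simp add: D_def ell2_nth_gather ell2_nth_sum ell2_nth_single ell2_nth_spread)
  have "cinner (D i h) (D k h') = (if i = k then cinner h h' else 0) - cinner (T i h) (T k h')"
    if i: "i \<in> I" and k: "k \<in> I" for i k h h'
  proof -
    have "cinner (D i h) (D k h') =
      (\<Sum>p\<in>I. cinner ((if p = i then h else 0) - T' p (T i h)) ((if p = k then h' else 0) - T' p (T k h')))
      + cinner (F (T i h)) (T k h')"
      by (subst (1) D_def) (simp add: cinner_add_left cinner_sum_left cinner_single_left nth gth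
          cinner_spread_left \<Delta>)
    also have "(\<Sum>p\<in>I. cinner ((if p = i then h else 0) - T' p (T i h)) ((if p = k then h' else 0) - T' p (T k h')))
      = (\<Sum>p\<in>I. (if p = i then if i = k then cinner h h' else 0 else 0)) 
        - (\<Sum>p\<in>I. if p = i then cinner h (T' p (T k h')) else 0)
        - (\<Sum>p\<in>I. if p = k then cinner (T' p (T i h)) h' else 0) + (\<Sum>p\<in>I. cinner (T' p (T i h)) (T' p (T k h')))"
      unfolding sum_subtractf[symmetric] sum.distrib[symmetric]
      by (rule sum.cong) (auto simp: cinner_diff_left cinner_diff_right)
    also have "\<dots> = (if i = k then cinner h h' else 0) - 2 * cinner (T i h) (T k h')
        + (\<Sum>p\<in>I. cinner (T' p (T i h)) (T' p (T k h')))"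
      using fin i k by (simp add: adj[OF k] flip: adj(1)[OF i])
    finally show ?thesis by (simp add: inner_F)
  qed
  moreover have "clinear_on UNIV (D i)" if "i \<in> I" for i
  proof -
    have entry: "clinear_on UNIV (\<lambda>h. (if p = i then h else 0) - T' p (T i h))" if "p \<in> I" for p
      by (intro clinear_minus_fun clinear_compose[OF linT' linT] that \<open>i \<in> I\<close>)
        (auto simp: clinear_on_UNIV_iff)
    show ?thesis
      unfolding D_def
      by (intro clinear_plus clinear_sum_fun clinear_compose[OF clinear_single entry]
          clinear_compose[OF clinear_spread clinear_compose[OF lin\<Delta> linT[OF that]]])
  qed
  ultimately show ?thesis by blast
qed

section \<open>Block-diagonal operators\<close>

lemma has_sum_norm_ell2: "((\<lambda>i. (norm (ell2_nth x i))\<^sup>2) has_sum (norm x)\<^sup>2) UNIV"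
  unfolding norm_ell2_sq by (rule has_sum_infsum[OF summable_ell2_nth])

lemma inj_Pair_left [simp]: "inj (Pair k)"
  by (simp add: inj_on_def)

lemma ell2_nth_block [simp]: "ell2_nth (gather (Pair k) x) j = ell2_nth x (k, j)"
  by (simp add: ell2_nth_gather)

lemma ell2_blocks_eqI: "(\<And>k. gather (Pair k) x = gather (Pair k) y) \<Longrightarrow> x = y"
  by (rule ell2_eqI) (metis ell2_nth_block surj_pair)

lemma has_sum_norm_blocks: "((\<lambda>k. (norm (gather (Pair k) x))\<^sup>2) has_sum (norm x)\<^sup>2) UNIV"
proof -
  have "((\<lambda>p. (norm (ell2_nth x p))\<^sup>2) has_sum (norm x)\<^sup>2) (SIGMA k:UNIV. UNIV)"
    using has_sum_norm_ell2[of x] by simp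
  moreover have "((\<lambda>j. (norm (ell2_nth x (k, j)))\<^sup>2) has_sum (norm (gather (Pair k) x))\<^sup>2) UNIV" for k
    using has_sum_norm_ell2[of "gather (Pair k) x"] by simp
  ultimately show ?thesis by (rule has_sum_SigmaD)
qed

lemma blockwise_isometry:
  fixes g :: "'k \<Rightarrow> ('j, 'a::complex_inner) ell2 \<Rightarrow> ('j, 'a) ell2"
  assumes iso: "\<And>k. isometry_on UNIV (g k)"
  shows "\<exists>G :: ('k \<times> 'j, 'a) ell2 \<Rightarrow> ('k \<times> 'j, 'a) ell2. isometry_on UNIV G \<and>
    (\<forall>k x. gather (Pair k) (G x) = g k (gather (Pair k) x))"
proof -
  have lin: "clinear_on UNIV (g k)" and nrm: "norm (g k x) = norm x" for k x
    using iso[of k] by (auto simp: isometry_on_def)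
  define G :: "('k \<times> 'j, 'a) ell2 \<Rightarrow> ('k \<times> 'j, 'a) ell2" where
    "G x = Abs_ell2 (\<lambda>(k, j). ell2_nth (g k (gather (Pair k) x)) j)" for x
  have "(\<lambda>p. (norm (case p of (k, j) \<Rightarrow> ell2_nth (g k (gather (Pair k) x)) j))\<^sup>2)
      summable_on (SIGMA k:UNIV. UNIV)" for x
  proof (rule summable_on_SigmaI)
    show "((\<lambda>j. (norm (case (k, j) of (k, j) \<Rightarrow> ell2_nth (g k (gather (Pair k) x)) j))\<^sup>2)
        has_sum (norm (gather (Pair k) x))\<^sup>2) UNIV" for k
      using has_sum_norm_ell2[of "g k (gather (Pair k) x)"] by (simp add: nrm)
    show "(\<lambda>k. (norm (gather (Pair k) x))\<^sup>2) summable_on UNIV"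
      using has_sum_norm_blocks by (rule has_sum_imp_summable)
  qed auto
  then have nth: "ell2_nth (G x) (k, j) = ell2_nth (g k (gather (Pair k) x)) j" for x k j
    unfolding G_def by (subst Abs_ell2_inverse) auto
  have blk: "gather (Pair k) (G x) = g k (gather (Pair k) x)" for k x
    by (rule ell2_eqI) (simp add: nth)
  have "clinear_on UNIV G"
    by (rule clinear_onI; rule ell2_blocks_eqI)
      (simp_all add: blk clinear_add[OF lin] clinear_scaleC[OF lin]
        clinear_add[OF clinear_gather] clinear_scaleC[OF clinear_gather])
  moreover have "norm (G x) = norm x" for x
  proof -
    have "((\<lambda>k. (norm (gather (Pair k) x))\<^sup>2) has_sum (norm (G x))\<^sup>2) UNIV"
      using has_sum_norm_blocks[of "G x"] by (simp add: blk nrm)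
    then have "(norm (G x))\<^sup>2 = (norm x)\<^sup>2"
      using has_sum_norm_blocks[of x] has_sum_unique by blast
    then show ?thesis by simp
  qed
  ultimately show ?thesis using blk by (auto simp: isometry_on_def)
qed

lemma blockwise_unitary:
  fixes g :: "'k \<Rightarrow> ('j, 'a::complex_inner) ell2 \<Rightarrow> ('j, 'a) ell2"
  assumes g: "\<And>k. unitary_operator (g k)"
  shows "\<exists>G :: ('k \<times> 'j, 'a) ell2 \<Rightarrow> ('k \<times> 'j, 'a) ell2. unitary_operator G \<and>
    (\<forall>k x. gather (Pair k) (G x) = g k (gather (Pair k) x))"
proof -
  obtain G :: "('k \<times> 'j, 'a) ell2 \<Rightarrow> ('k \<times> 'j, 'a) ell2"
    where G: "isometry_on UNIV G" "\<And>k x. gather (Pair k) (G x) = g k (gather (Pair k) x)"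
    using blockwise_isometry[of g] unitary_operator_isometry[OF g] by blast
  obtain G' :: "('k \<times> 'j, 'a) ell2 \<Rightarrow> ('k \<times> 'j, 'a) ell2"
    where G': "\<And>k x. gather (Pair k) (G' x) = inv (g k) (gather (Pair k) x)"
    using blockwise_isometry[of "\<lambda>k. inv (g k)"]
      unitary_operator_isometry[OF unitary_operator_inv(1)[OF g]] by blast
  have "G (G' x) = x" for x
    by (rule ell2_blocks_eqI) (simp add: G G' unitary_operator_inv(3)[OF g])
  then have "surj G" by (metis surjI)
  with G show ?thesis by (auto simp: unitary_operator_def)
qed

section \<open>Transporting a unitary through shuffles of coordinates\<close>

text \<open>The injections \<open>f p\<close> with \<open>p \<in> P\<close> have disjoint ranges that exhaust the index set.  Then the
  isometries \<open>spread (f p)\<close> satisfy the Cuntz relations: their ranges are orthogonal and span the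
  whole space.\<close>

definition index_partition :: "'p set \<Rightarrow> ('p \<Rightarrow> 'j \<Rightarrow> 'j) \<Rightarrow> bool" where
  "index_partition P f \<longleftrightarrow> bij_betw (\<lambda>(p, j). f p j) (P \<times> UNIV) UNIV"

lemma index_partition_eq_iff:
  assumes "index_partition P f" "p \<in> P" "q \<in> P"
  shows "f p i = f q j \<longleftrightarrow> p = q \<and> i = j"
proof -
  have "inj_on (\<lambda>(p, j). f p j) (P \<times> UNIV)"
    using assms(1) by (simp add: index_partition_def bij_betw_def)
  from inj_on_eq_iff[OF this, of "(p, i)" "(q, j)"] assms(2,3) show ?thesis by simp
qed

lemma index_partition_inj: "index_partition P f \<Longrightarrow> p \<in> P \<Longrightarrow> inj (f p)"
  by (rule injI) (simp add: index_partition_eq_iff)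

lemma gather_spread_partition:
  assumes "index_partition P f" "p \<in> P" "q \<in> P"
  shows "gather (f p) (spread (f q) x) = (if p = q then x else 0)"
  using assms by (auto simp: gather_spread index_partition_inj index_partition_eq_iff
      intro!: gather_spread_disjoint)

lemma sum_spread_gather_partition:
  assumes "finite P" and f: "index_partition P f"
  shows "(\<Sum>p\<in>P. spread (f p) (gather (f p) z)) = z"
proof (rule ell2_eqI)
  fix j
  from f have "j \<in> (\<lambda>(p, j). f p j) ` (P \<times> UNIV)"
    unfolding index_partition_def bij_betw_def by blast
  then obtain p i where p: "p \<in> P" and j: "j = f p i" by auto
  have "ell2_nth (spread (f q) (gather (f q) z)) j = (if q = p then ell2_nth z j else 0)"
    if q: "q \<in> P" for q
  proof (cases "q = p")
    case True
    then show ?thesis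
      using index_partition_inj[OF f p] by (simp add: j ell2_nth_spread ell2_nth_gather)
  next
    case False
    then have "j \<notin> range (f q)" using index_partition_eq_iff[OF f p q] j by auto
    with False show ?thesis by (simp add: ell2_nth_spread_outside)
  qed
  then show "ell2_nth (\<Sum>p\<in>P. spread (f p) (gather (f p) z)) j = ell2_nth z j"
    using assms(1) p by (simp add: ell2_nth_sum)
qed

lemma cinner_combinations:
  "cinner (\<Sum>q\<in>Q. a q *\<^sub>C v q) (\<Sum>r\<in>R. b r *\<^sub>C (w r :: 'a::complex_inner)) =
    (\<Sum>q\<in>Q. \<Sum>r\<in>R. a q * (cnj (b r) * cinner (v q) (w r)))"
  unfolding cinner_sum_left
  by (intro sum.cong refl) (simp only: cinner_scaleC_left cinner_sum_right cinner_scaleC_right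
    sum_distrib_left mult.left_commute)

text \<open>The Gram matrix \<open>c 1 - \<langle>s, t\<rangle>\<close> of a family keeps its form when a unitary matrix acts on the family,
  as the identity part is invariant.  With \<open>s = t = 0\<close> this says that unitary combinations of
  orthogonal isometries are again orthogonal isometries.\<close>

lemma unitary_mixing_gram:
  fixes v w :: "'p \<Rightarrow> 'x::complex_inner" and s t :: "'p \<Rightarrow> 'y::complex_inner"
  assumes fin: "finite P" and u: "unitary_matrix_on P u"
    and gram: "\<And>q r. q \<in> P \<Longrightarrow> r \<in> P \<Longrightarrow>
      cinner (v q) (w r) = (if q = r then c else 0) - cinner (s q) (t r)"
    and p: "p \<in> P" "p' \<in> P"
  shows "cinner (\<Sum>q\<in>P. u p q *\<^sub>C v q) (\<Sum>r\<in>P. u p' r *\<^sub>C w r) =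
    (if p = p' then c else 0) - cinner (\<Sum>q\<in>P. u p q *\<^sub>C s q) (\<Sum>r\<in>P. u p' r *\<^sub>C t r)"
proof -
  have "cinner (\<Sum>q\<in>P. u p q *\<^sub>C v q) (\<Sum>r\<in>P. u p' r *\<^sub>C w r) =
      (\<Sum>q\<in>P. \<Sum>r\<in>P. u p q * (cnj (u p' r) * cinner (v q) (w r)))"
    by (rule cinner_combinations)
  also have "\<dots> =
      (\<Sum>q\<in>P. \<Sum>r\<in>P. u p q * (cnj (u p' r) * ((if q = r then c else 0) - cinner (s q) (t r))))"
    by (intro sum.cong refl) (simp only: gram)
  also have "\<dots> = (\<Sum>q\<in>P. \<Sum>r\<in>P. if q = r then u p q * cnj (u p' r) * c else 0)
      - (\<Sum>q\<in>P. \<Sum>r\<in>P. u p q * (cnj (u p' r) * cinner (s q) (t r)))"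
    unfolding sum_subtractf[symmetric]
    by (intro sum.cong refl) (simp add: algebra_simps)
  also have "(\<Sum>q\<in>P. \<Sum>r\<in>P. if q = r then u p q * cnj (u p' r) * c else 0) =
      (\<Sum>q\<in>P. u p q * cnj (u p' q)) * c"
    using fin by (simp add: sum_distrib_right)
  also have "(\<Sum>q\<in>P. u p q * cnj (u p' q)) = (if p = p' then 1 else 0)"
    using u p by (simp add: unitary_matrix_on_def)
  also have "(\<Sum>q\<in>P. \<Sum>r\<in>P. u p q * (cnj (u p' r) * cinner (s q) (t r))) =
      cinner (\<Sum>q\<in>P. u p q *\<^sub>C s q) (\<Sum>r\<in>P. u p' r *\<^sub>C t r)"
    by (rule cinner_combinations[symmetric])
  finally show ?thesis by simp
qed

text \<open>Both families \<open>spread (f p)\<close> and \<open>\<tau> p = \<Sum>\<^sub>q u p q (spread (g q))\<close> satisfy the Cuntz relations with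
  full range, the second because \<open>u\<close> is unitary.  The required values therefore determine
  \<open>G' = \<Sum>\<^sub>p \<tau> p G (spread (f p))\<^sup>*\<close>, and this operator is unitary.\<close>

lemma unitary_intertwiner:
  fixes f g :: "'p \<Rightarrow> 'j \<Rightarrow> 'j" and G :: "('j, 'a::complex_inner) ell2 \<Rightarrow> ('j, 'a) ell2"
  assumes fin: "finite P" and u: "unitary_matrix_on P u"
    and f: "index_partition P f" and g: "index_partition P g" and G: "unitary_operator G"
  shows "\<exists>G'. unitary_operator G' \<and>
    (\<forall>p\<in>P. \<forall>z. G' (spread (f p) z) = (\<Sum>q\<in>P. u p q *\<^sub>C spread (g q) (G z)))"
proof -
  note linG = unitary_operator_clinear[OF G]
  define \<tau> where "\<tau> p z = (\<Sum>q\<in>P. u p q *\<^sub>C spread (g q) z)"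
    for p and z :: "('j, 'a) ell2"
  define G' where "G' z = (\<Sum>p\<in>P. \<tau> p (G (gather (f p) z)))" for z
  have lin\<tau>: "clinear_on UNIV (\<tau> p)" for p
    unfolding \<tau>_def by (intro clinear_sum_fun clinear_scaleC_fun clinear_spread)
  have lin: "clinear_on UNIV G'"
    unfolding G'_def
    by (intro clinear_sum_fun clinear_compose[OF lin\<tau> clinear_compose[OF linG clinear_gather]])
  have inter: "G' (spread (f p) z) = \<tau> p (G z)" if p: "p \<in> P" for p z
  proof -
    have "G' (spread (f p) z) = (\<Sum>q\<in>P. if q = p then \<tau> p (G z) else 0)"
      unfolding G'_def
      by (intro sum.cong refl)
        (auto simp: gather_spread_partition[OF f _ p] clinear_zero[OF linG] clinear_zero[OF lin\<tau>])
    then show ?thesis using fin p by simp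
  qed
  have gram\<tau>: "cinner (\<tau> p x) (\<tau> p' y) = (if p = p' then cinner x y else 0)"
    if "p \<in> P" "p' \<in> P" for p p' x y
  proof -
    have "cinner (spread (g q) x) (spread (g r) y) = (if q = r then cinner x y else 0) - cinner (0 :: 'a) 0"
      if "q \<in> P" "r \<in> P" for q r
      using that by (simp add: cinner_spread_left index_partition_inj[OF g] gather_spread_partition[OF g])
    from unitary_mixing_gram[OF fin u this \<open>p \<in> P\<close> \<open>p' \<in> P\<close>] show ?thesis
      by (simp add: \<tau>_def)
  qed
  have "cinner (G' z) (G' z) = cinner z z" for z
  proof -
    have "cinner (G' z) (G' z) = (\<Sum>p\<in>P. cinner (gather (f p) z) (gather (f p) z))"
      using fin
      by (simp add: G'_def cinner_sum_left cinner_sum_right gram\<tau>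
          isometry_cinner[OF unitary_operator_isometry[OF G]] cong: sum.cong)
    also have "\<dots> = cinner (\<Sum>p\<in>P. spread (f p) (gather (f p) z)) z"
      by (simp add: cinner_sum_left cinner_spread_left index_partition_inj[OF f] cong: sum.cong)
    finally show ?thesis by (simp add: sum_spread_gather_partition[OF fin f])
  qed
  then have "isometry_on UNIV G'" by (rule isometryI[OF lin])
  moreover have "y \<in> range G'" for y
  proof -
    \<comment> \<open>The coordinates of \<open>y\<close> with respect to the family \<open>\<tau>\<close>, by the adjoint matrix.\<close>
    define w where "w p = (\<Sum>r\<in>P. cnj (u p r) *\<^sub>C gather (g r) y)" for p
    have col: "(\<Sum>p\<in>P. u p q *\<^sub>C w p) = gather (g q) y" if q: "q \<in> P" for q
    proof -
      have "(\<Sum>p\<in>P. u p q *\<^sub>C w p) = (\<Sum>p\<in>P. \<Sum>r\<in>P. (cnj (u p r) * u p q) *\<^sub>C gather (g r) y)"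
        by (simp add: w_def scaleC_sum_right scaleC_scaleC mult.commute)
      also have "\<dots> = (\<Sum>r\<in>P. (\<Sum>p\<in>P. cnj (u p r) * u p q) *\<^sub>C gather (g r) y)"
        unfolding scaleC_sum_left by (rule sum.swap)
      also have "\<dots> = (\<Sum>r\<in>P. if r = q then gather (g q) y else 0)"
        using u q by (intro sum.cong refl) (auto simp: unitary_matrix_on_def scaleC_one)
      finally show ?thesis using fin q by simp
    qed
    have "G' (\<Sum>p\<in>P. spread (f p) (inv G (w p))) = (\<Sum>p\<in>P. \<tau> p (w p))"
      by (simp add: clinear_sum[OF lin] inter unitary_operator_inv(3)[OF G] cong: sum.cong)
    also have "\<dots> = (\<Sum>q\<in>P. \<Sum>p\<in>P. u p q *\<^sub>C spread (g q) (w p))"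
      unfolding \<tau>_def by (rule sum.swap)
    also have "\<dots> = (\<Sum>q\<in>P. spread (g q) (\<Sum>p\<in>P. u p q *\<^sub>C w p))"
      by (simp add: clinear_sum[OF clinear_spread] clinear_scaleC[OF clinear_spread])
    also have "\<dots> = y"
      using sum_spread_gather_partition[OF fin g] by (simp add: col cong: sum.cong)
    finally show ?thesis by blast
  qed
  ultimately have "unitary_operator G'" unfolding unitary_operator_def by blast
  then show ?thesis using inter unfolding \<tau>_def by blast
qed

lemma gather_block_spread_block:
  "gather (Pair k) (spread (Pair l) x) = (if k = l then x else 0)"
  by (auto simp: gather_spread intro: gather_spread_disjoint)

lemma inj_Suc_block: "inj f \<Longrightarrow> inj (\<lambda>(k, j). (Suc k, f j))"
  by (auto simp: inj_on_def)

lemma gather_block_spread_Suc: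
  assumes "inj f"
  shows "gather (Pair 0) (spread (\<lambda>(k, j). (Suc k, f j)) x) = 0"
    and "gather (Pair (Suc k)) (spread (\<lambda>(k, j). (Suc k, f j)) x) = spread f (gather (Pair k) x)"
proof -
  show "gather (Pair 0) (spread (\<lambda>(k, j). (Suc k, f j)) x) = 0"
    by (rule gather_spread_disjoint) auto
  show "gather (Pair (Suc k)) (spread (\<lambda>(k, j). (Suc k, f j)) x) = spread f (gather (Pair k) x)"
  proof (rule ell2_eqI)
    fix j
    show "ell2_nth (gather (Pair (Suc k)) (spread (\<lambda>(k, j). (Suc k, f j)) x)) j =
        ell2_nth (spread f (gather (Pair k) x)) j"
    proof (cases "j \<in> range f")
      case True
      then obtain i where "j = f i" by blast
      then show ?thesis
        using ell2_nth_spread[OF inj_Suc_block[OF assms], of x "(k, i)"]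
        by (simp add: ell2_nth_spread assms)
    next
      case False
      then have "(Suc k, j) \<notin> range (\<lambda>(k, j). (Suc k, f j))" by auto
      with False show ?thesis by (simp add: ell2_nth_spread_outside)
    qed
  qed
qed

text \<open>\<open>G\<close> is block diagonal.  Its block at level \<open>0\<close> is the reflection that exchanges the two families; as the
  intertwining relation moves level \<open>k\<close> to level \<open>Suc k\<close>, every block determines the next one.\<close>

lemma intertwining_unitary_exists:
  fixes f g :: "'p \<Rightarrow> 'j \<Rightarrow> 'j" and M N :: "'p \<Rightarrow> 'h \<Rightarrow> ('j, 'a::complex_hilbert) ell2"
  assumes fin: "finite P" and u: "unitary_matrix_on P u"
    and f: "index_partition P f" and g: "index_partition P g"
    and gram: "\<And>p q h h'. p \<in> P \<Longrightarrow> q \<in> P \<Longrightarrow> cinner (M p h) (M q h') = cinner (N p h) (N q h')"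
    and orth: "\<And>p q h h'. p \<in> P \<Longrightarrow> q \<in> P \<Longrightarrow> cinner (M p h) (N q h') = 0"
  shows "\<exists>G :: (nat \<times> 'j, 'a) ell2 \<Rightarrow> (nat \<times> 'j, 'a) ell2. unitary_operator G \<and>
    (\<forall>p\<in>P. \<forall>z. G (spread (\<lambda>(k, j). (Suc k, f p j)) z) =
       (\<Sum>q\<in>P. u p q *\<^sub>C spread (\<lambda>(k, j). (Suc k, g q j)) (G z))) \<and>
    (\<forall>p\<in>P. \<forall>h. G (spread (Pair 0) (M p h)) = spread (Pair 0) (N p h))"
proof -
  obtain R where R: "unitary_operator R" "\<And>p h. p \<in> P \<Longrightarrow> R (M p h) = N p h"
    using reflection_swapping_families[of "P \<times> UNIV" "\<lambda>(p, h). M p h" "\<lambda>(p, h). N p h"] gram orth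
    by auto
  have "\<exists>\<Phi>. \<forall>G :: ('j, 'a) ell2 \<Rightarrow> ('j, 'a) ell2. unitary_operator G \<longrightarrow> unitary_operator (\<Phi> G) \<and>
    (\<forall>p\<in>P. \<forall>z. \<Phi> G (spread (f p) z) = (\<Sum>q\<in>P. u p q *\<^sub>C spread (g q) (G z)))"
    by (rule choice) (use unitary_intertwiner[OF fin u f g] in blast)
  then obtain \<Phi> where \<Phi>: "\<And>G :: ('j, 'a) ell2 \<Rightarrow> ('j, 'a) ell2. unitary_operator G \<Longrightarrow> unitary_operator (\<Phi> G)"
    "\<And>G p z. unitary_operator G \<Longrightarrow> p \<in> P \<Longrightarrow>
      \<Phi> G (spread (f p) z) = (\<Sum>q\<in>P. u p q *\<^sub>C spread (g q) (G z))"
    by blast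
  define \<gamma> where "\<gamma> k = (\<Phi> ^^ k) R" for k
  have \<gamma>: "unitary_operator (\<gamma> k)" for k
    by (induction k) (auto simp: \<gamma>_def R \<Phi>)
  then obtain G :: "(nat \<times> 'j, 'a) ell2 \<Rightarrow> (nat \<times> 'j, 'a) ell2"
    where G: "unitary_operator G" "\<And>k x. gather (Pair k) (G x) = \<gamma> k (gather (Pair k) x)"
    using blockwise_unitary[of \<gamma>] by blast
  note \<gamma>0 = clinear_zero[OF unitary_operator_clinear[OF \<gamma>]]
  note gather_lin = clinear_sum[OF clinear_gather] clinear_scaleC[OF clinear_gather]
  have "G (spread (\<lambda>(k, j). (Suc k, f p j)) z) =
      (\<Sum>q\<in>P. u p q *\<^sub>C spread (\<lambda>(k, j). (Suc k, g q j)) (G z))" if p: "p \<in> P" for p z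
  proof (rule ell2_blocks_eqI)
    fix k
    note blk = gather_block_spread_Suc[OF index_partition_inj[OF f p]]
      gather_block_spread_Suc[OF index_partition_inj[OF g]]
    show "gather (Pair k) (G (spread (\<lambda>(k, j). (Suc k, f p j)) z)) =
      gather (Pair k) (\<Sum>q\<in>P. u p q *\<^sub>C spread (\<lambda>(k, j). (Suc k, g q j)) (G z))"
    proof (cases k)
      case 0
      then show ?thesis by (simp add: G gather_lin blk \<gamma>0 cong: sum.cong)
    next
      case (Suc l)
      have "\<gamma> (Suc l) (spread (f p) z) = (\<Sum>q\<in>P. u p q *\<^sub>C spread (g q) (\<gamma> l z))" for z
        using \<Phi>(2)[OF \<gamma>[of l] p] by (simp add: \<gamma>_def)
      then show ?thesis by (simp add: Suc G gather_lin blk cong: sum.cong)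
    qed
  qed
  moreover have "G (spread (Pair 0) (M p h)) = spread (Pair 0) (N p h)" if "p \<in> P" for p h
    by (rule ell2_blocks_eqI) (simp add: G gather_block_spread_block \<gamma>0, simp add: \<gamma>_def R that)
  ultimately show ?thesis using G(1) by blast
qed

section \<open>Isometries with orthogonal ranges\<close>

text \<open>The vector \<open>w = \<Sum>\<^sub>i V\<^sub>i V\<^sub>i\<^sup>* x\<close> is the projection of \<open>x\<close> to the sum of the ranges, so
  \<open>\<langle>x - w, x\<rangle> = \<parallel>x - w\<parallel>\<^sup>2\<close>.\<close>

lemma row_contraction_of_isometries:
  fixes V :: "'i \<Rightarrow> 'a::complex_hilbert \<Rightarrow> 'a"
  assumes fin: "finite I" and bdd: "\<And>i. i \<in> I \<Longrightarrow> bounded_operator_on UNIV (V i)"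
    and gram: "\<And>i k x y. i \<in> I \<Longrightarrow> k \<in> I \<Longrightarrow>
      cinner (V i x) (V k y) = (if i = k then cinner x y else 0)"
  shows "row_contraction_on UNIV I V"
  unfolding row_contraction_on_def op_le_on_def
proof
  fix x :: 'a
  define w where "w = (\<Sum>i\<in>I. V i (adjoint_on UNIV (V i) x))"
  have wx: "cinner w x = (\<Sum>i\<in>I. cinner (adjoint_on UNIV (V i) x) (adjoint_on UNIV (V i) x))"
    unfolding w_def cinner_sum_left by (intro sum.cong refl) (rule cinner_adjoint[OF bdd])
  have ww: "cinner w w = cinner w x"
  proof -
    have "cinner w w = (\<Sum>i\<in>I. \<Sum>k\<in>I.
        if i = k then cinner (adjoint_on UNIV (V i) x) (adjoint_on UNIV (V k) x) else 0)"
      unfolding w_def cinner_sum_left cinner_sum_right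
      by (intro sum.cong refl) (auto simp: gram)
    then show ?thesis using fin by (simp add: wx)
  qed
  have "cinner x w = cinner w x"
    by (metis ww cinner_commute)
  then have "cinner (x - w) x = cinner (x - w) (x - w)"
    by (simp add: cinner_diff_left cinner_diff_right ww)
  then show "cinner (x - (\<Sum>i\<in>I. V i (adjoint_on UNIV (V i) x))) x \<in> \<real>\<^sub>\<ge>\<^sub>0"
    by (simp add: w_def[symmetric] cinner_self)
qed

section \<open>The unitary in the construction of Ando\<close>

lemma index_partitionI:
  assumes "\<And>p q i j. p \<in> P \<Longrightarrow> q \<in> P \<Longrightarrow> f p i = f q j \<Longrightarrow> p = q \<and> i = j"
    and "\<And>x. \<exists>p\<in>P. \<exists>i. x = f p i"
  shows "index_partition P f"
  unfolding index_partition_def bij_betw_def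
proof
  show "inj_on (\<lambda>(p, j). f p j) (P \<times> UNIV)"
  proof (rule inj_onI)
    fix x y assume "x \<in> P \<times> UNIV" "y \<in> P \<times> UNIV" "(\<lambda>(p, j). f p j) x = (\<lambda>(p, j). f p j) y"
    then show "x = y"
      using assms(1)[of "fst x" "fst y" "snd x" "snd y"] by (auto simp: prod_eq_iff case_prod_unfold)
  qed
  have "x \<in> (\<lambda>(p, j). f p j) ` (P \<times> UNIV)" for x
  proof -
    obtain p i where "p \<in> P" "x = f p i" using assms(2) by blast
    then show ?thesis by (intro image_eqI[of _ _ "(p, i)"]) auto
  qed
  then show "(\<lambda>(p, j). f p j) ` (P \<times> UNIV) = UNIV" by blast
qed

lemma index_partition_ex:
  assumes "index_partition P f" shows "\<exists>p\<in>P. \<exists>i. x = f p i"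
proof -
  have "x \<in> (\<lambda>(p, j). f p j) ` (P \<times> UNIV)"
    using assms unfolding index_partition_def bij_betw_def by blast
  then show ?thesis by auto
qed

lemma index_partition_residues:
  fixes n :: nat
  assumes "n > 0" shows "index_partition {1..n} (\<lambda>i p. p * n + (i - 1))"
proof (rule index_partitionI)
  fix i k p q assume i: "i \<in> {1..n}" and k: "k \<in> {1..n}" and eq: "p * n + (i - 1) = q * n + (k - 1)"
  have "i - 1 < n" "k - 1 < n" using i k by auto
  then have "i - 1 = k - 1"
    using arg_cong[OF eq, of "\<lambda>t. t mod n"] by (simp only: mod_mult_self3 mod_less)
  then have "i = k" using i k by (simp add: eq_diff_iff)
  then show "i = k \<and> p = q" using eq assms by simp
next
  fix x
  have "x = x div n * n + (Suc (x mod n) - 1)" by simp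
  moreover have "Suc (x mod n) \<in> {1..n}" using assms by (simp add: Suc_leI)
  ultimately show "\<exists>i\<in>{1..n}. \<exists>p. x = p * n + (i - 1)" by blast
qed

text \<open>Within a level, an index consists of a bit for the half of the level, a bit that keeps the values
  of the two defect operators apart, a number that is shuffled by the injections of an index
  partition, and a coordinate of the defect space.\<close>

definition on_shuffle_coordinate :: "(nat \<Rightarrow> nat) \<Rightarrow> bool \<times> bool \<times> nat \<times> 'd \<Rightarrow> bool \<times> bool \<times> nat \<times> 'd" where
  "on_shuffle_coordinate e = (\<lambda>(b, c, p, d). (b, c, e p, d))"

lemma index_partition_compose:
  assumes \<alpha>: "index_partition I \<alpha>" and \<beta>: "index_partition J \<beta>"
  shows "index_partition (I \<times> J)
      (\<lambda>p. on_shuffle_coordinate (\<lambda>t. \<alpha> (fst p) (\<beta> (snd p) t)) :: bool \<times> bool \<times> nat \<times> 'd \<Rightarrow> _)"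
    and "index_partition (I \<times> J)
      (\<lambda>p. on_shuffle_coordinate (\<lambda>t. \<beta> (snd p) (\<alpha> (fst p) t)) :: bool \<times> bool \<times> nat \<times> 'd \<Rightarrow> _)"
proof -
  note eq = index_partition_eq_iff[OF \<alpha>] index_partition_eq_iff[OF \<beta>]
  show "index_partition (I \<times> J)
      (\<lambda>p. on_shuffle_coordinate (\<lambda>t. \<alpha> (fst p) (\<beta> (snd p) t)) :: bool \<times> bool \<times> nat \<times> 'd \<Rightarrow> _)"
  proof (rule index_partitionI)
    fix x :: "bool \<times> bool \<times> nat \<times> 'd"
    obtain b c t d where x: "x = (b, c, t, d)" by (metis surj_pair)
    obtain i s where i: "i \<in> I" "t = \<alpha> i s" using index_partition_ex[OF \<alpha>] by blast
    obtain j r where j: "j \<in> J" "s = \<beta> j r" using index_partition_ex[OF \<beta>] by blast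
    have "x = on_shuffle_coordinate (\<lambda>t. \<alpha> (fst (i, j)) (\<beta> (snd (i, j)) t)) (b, c, r, d)"
      by (simp add: x i j on_shuffle_coordinate_def)
    with i(1) j(1) show "\<exists>p\<in>I \<times> J. \<exists>y. x = on_shuffle_coordinate (\<lambda>t. \<alpha> (fst p) (\<beta> (snd p) t)) y" by blast
  qed (auto simp: on_shuffle_coordinate_def eq)
  show "index_partition (I \<times> J)
      (\<lambda>p. on_shuffle_coordinate (\<lambda>t. \<beta> (snd p) (\<alpha> (fst p) t)) :: bool \<times> bool \<times> nat \<times> 'd \<Rightarrow> _)"
  proof (rule index_partitionI)
    fix x :: "bool \<times> bool \<times> nat \<times> 'd"
    obtain b c t d where x: "x = (b, c, t, d)" by (metis surj_pair)
    obtain j s where j: "j \<in> J" "t = \<beta> j s" using index_partition_ex[OF \<beta>] by blast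
    obtain i r where i: "i \<in> I" "s = \<alpha> i r" using index_partition_ex[OF \<alpha>] by blast
    have "x = on_shuffle_coordinate (\<lambda>t. \<beta> (snd (i, j)) (\<alpha> (fst (i, j)) t)) (b, c, r, d)"
      by (simp add: x i j on_shuffle_coordinate_def)
    with i(1) j(1) show "\<exists>p\<in>I \<times> J. \<exists>y. x = on_shuffle_coordinate (\<lambda>t. \<beta> (snd p) (\<alpha> (fst p) t)) y" by blast
  qed (auto simp: on_shuffle_coordinate_def eq)
qed

text \<open>The indices of the space that is added to \<open>H\<close>; the first component is the level.\<close>

type_synonym 'd room = "nat \<times> bool \<times> bool \<times> nat \<times> 'd"

text \<open>A shift by half a level.  The product of two such shifts raises the level by one and preserves the
  half, which is what lets a block-diagonal unitary commute with it up to \<open>u\<close>.\<close>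

definition half_shift :: "(nat \<Rightarrow> nat) \<Rightarrow> 'd room \<Rightarrow> 'd room" where
  "half_shift e = (\<lambda>(k, b, c, p, d). if b then (Suc k, False, c, e p, d) else (k, True, c, e p, d))"

text \<open>The places where the defect operators enter, outside the range of every half shift.\<close>

definition entrance :: "bool \<Rightarrow> 'd \<Rightarrow> 'd room" where
  "entrance c d = (0, False, c, 0, d)"

lemma half_shift_eq_iff: "half_shift e x = half_shift e' y \<longleftrightarrow>
    (case (x, y) of ((k, b, c, p, d), (k', b', c', p', d')) \<Rightarrow>
      k = k' \<and> b = b' \<and> c = c' \<and> e p = e' p' \<and> d = d')"
  by (auto simp: half_shift_def split: prod.splits if_splits)

lemma inj_half_shift: "inj e \<Longrightarrow> inj (half_shift e)"
  by (rule injI) (auto simp: half_shift_eq_iff dest: injD)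

lemma inj_entrance: "inj (entrance c)"
  by (rule injI) (simp add: entrance_def)

lemma half_shift_neq_entrance: "half_shift e x \<noteq> entrance c d"
  by (auto simp: half_shift_def entrance_def split: prod.splits)

lemma half_shift_half_shift:
  "half_shift e (half_shift e' x) = (\<lambda>(k, z). (Suc k, on_shuffle_coordinate (\<lambda>t. e (e' t)) z)) x"
  by (auto simp: half_shift_def on_shuffle_coordinate_def split: prod.splits)

lemma spread_half_shift_twice:
  assumes "inj e" "inj e'"
  shows "spread (half_shift e) (spread (half_shift e') x) =
    spread (\<lambda>(k, z). (Suc k, on_shuffle_coordinate (\<lambda>t. e (e' t)) z)) x"
  using assms by (simp add: spread_spread inj_half_shift half_shift_half_shift)

text \<open>The rows \<open>A\<close>, \<open>B\<close> of half shifts and the defect maps \<open>dT\<close>, \<open>dS\<close> form isometric dilations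
  \<open>(T, dT + A)\<close> and \<open>(S, dS + B)\<close> that need not satisfy the commutation relation: the two sides differ in
  the added space.  On the vectors coming from \<open>H\<close> the two sides have the components \<open>M\<close> and \<open>N\<close> at
  level \<open>0\<close>.  Both have Gram matrix \<open>1 - (TS)\<^sup>*(TS)\<close>, by the commutation relation of \<open>T\<close> and \<open>S\<close> and the
  unitarity of \<open>u\<close>.  They are orthogonal to each other, since in the lower half the first comes from the
  defect of \<open>T\<close> and the second from that of \<open>S\<close>, and conversely in the upper half.  Hence one unitary
  \<open>G\<close> of the added space corrects both differences.\<close>

lemma ando_unitary_exists:
  fixes T :: "'i \<Rightarrow> 'a::complex_hilbert \<Rightarrow> 'a" and S :: "'j \<Rightarrow> 'a \<Rightarrow> 'a"
    and DT :: "'i \<Rightarrow> 'a \<Rightarrow> ('d, 'a) ell2" and DS :: "'j \<Rightarrow> 'a \<Rightarrow> ('d, 'a) ell2"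
  defines "dT \<equiv> \<lambda>i h. spread (entrance False) (DT i h)"
    and "dS \<equiv> \<lambda>j h. spread (entrance True) (DS j h)"
  assumes fin: "finite I" "finite J" and u: "unitary_matrix_on (I \<times> J) u"
    and comm: "\<And>i j h. i \<in> I \<Longrightarrow> j \<in> J \<Longrightarrow>
      T i (S j h) = (\<Sum>q\<in>I \<times> J. u (i, j) q *\<^sub>C S (snd q) (T (fst q) h))"
    and DT: "\<And>i k h h'. i \<in> I \<Longrightarrow> k \<in> I \<Longrightarrow>
      cinner (DT i h) (DT k h') = (if i = k then cinner h h' else 0) - cinner (T i h) (T k h')"
    and DS: "\<And>j l h h'. j \<in> J \<Longrightarrow> l \<in> J \<Longrightarrow>
      cinner (DS j h) (DS l h') = (if j = l then cinner h h' else 0) - cinner (S j h) (S l h')"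
    and \<alpha>: "index_partition I \<alpha>" and \<beta>: "index_partition J \<beta>"
  defines "A \<equiv> \<lambda>i. spread (half_shift (\<alpha> i))" and "B \<equiv> \<lambda>j. spread (half_shift (\<beta> j))"
  shows "\<exists>G :: ('d room, 'a) ell2 \<Rightarrow> ('d room, 'a) ell2. unitary_operator G \<and>
    (\<forall>i\<in>I. \<forall>j\<in>J. \<forall>x. G (A i (B j x)) = (\<Sum>q\<in>I \<times> J. u (i, j) q *\<^sub>C B (snd q) (A (fst q) (G x)))) \<and>
    (\<forall>i\<in>I. \<forall>j\<in>J. \<forall>h. G (dT i (S j h) + A i (dS j h)) =
      (\<Sum>q\<in>I \<times> J. u (i, j) q *\<^sub>C (dS (snd q) (T (fst q) h) + B (snd q) (dT (fst q) h))))"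
proof -
  note inj\<alpha> = index_partition_inj[OF \<alpha>] and inj\<beta> = index_partition_inj[OF \<beta>]
  \<comment> \<open>The embedding of the defect space into a level at half \<open>b\<close>, defect bit \<open>c\<close> and number \<open>t\<close>.\<close>
  define \<iota> where "\<iota> b c t = (\<lambda>d::'d. (b::bool, c::bool, t::nat, d))" for b c t
  have inj\<iota>: "inj (\<iota> b c t)" for b c t by (simp add: \<iota>_def inj_on_def)
  have \<iota>: "cinner (spread (\<iota> b c t) x) (spread (\<iota> b' c' t') y) =
      (if b = b' \<and> c = c' \<and> t = t' then cinner x y else 0)" for b c t b' c' t' and x y :: "('d, 'a) ell2"
    using inj\<iota> by (auto simp: cinner_spread intro!: cinner_spread_disjoint) (auto simp: \<iota>_def)
  define M where "M p h = spread (\<iota> False False 0) (DT (fst p) (S (snd p) h))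
      + spread (\<iota> True True (\<alpha> (fst p) 0)) (DS (snd p) h)" for p h
  define N0 where "N0 p h = spread (\<iota> False True 0) (DS (snd p) (T (fst p) h))
      + spread (\<iota> True False (\<beta> (snd p) 0)) (DT (fst p) h)" for p h
  define N where "N p h = (\<Sum>q\<in>I \<times> J. u p q *\<^sub>C N0 q h)" for p h
  have gramM: "cinner (M p h) (M q h') = (if p = q then cinner h h' else 0)
      - cinner (T (fst p) (S (snd p) h)) (T (fst q) (S (snd q) h'))"
    if "p \<in> I \<times> J" "q \<in> I \<times> J" for p q h h'
    using that by (auto simp: M_def cinner_add_left cinner_add_right \<iota> DT DS
        index_partition_eq_iff[OF \<alpha>] split: if_splits)
  have gramN0: "cinner (N0 p h) (N0 q h') = (if p = q then cinner h h' else 0)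
      - cinner (S (snd p) (T (fst p) h)) (S (snd q) (T (fst q) h'))"
    if "p \<in> I \<times> J" "q \<in> I \<times> J" for p q h h'
    using that by (auto simp: N0_def cinner_add_left cinner_add_right \<iota> DT DS
        index_partition_eq_iff[OF \<beta>] split: if_splits)
  have "\<exists>G :: ('d room, 'a) ell2 \<Rightarrow> ('d room, 'a) ell2. unitary_operator G \<and>
    (\<forall>p\<in>I \<times> J. \<forall>z. G (spread (\<lambda>(k, z). (Suc k, on_shuffle_coordinate (\<lambda>t. \<alpha> (fst p) (\<beta> (snd p) t)) z)) z) =
       (\<Sum>q\<in>I \<times> J. u p q *\<^sub>C spread (\<lambda>(k, z). (Suc k, on_shuffle_coordinate (\<lambda>t. \<beta> (snd q) (\<alpha> (fst q) t)) z)) (G z))) \<and>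
    (\<forall>p\<in>I \<times> J. \<forall>h. G (spread (Pair 0) (M p h)) = spread (Pair 0) (N p h))"
  proof (rule intertwining_unitary_exists[OF _ u index_partition_compose[OF \<alpha> \<beta>]])
    show "finite (I \<times> J)" using fin by simp
    fix p q h h' assume p: "p \<in> I \<times> J" and q: "q \<in> I \<times> J"
    have comm': "T (fst p) (S (snd p) h) = (\<Sum>q\<in>I \<times> J. u p q *\<^sub>C S (snd q) (T (fst q) h))"
      if "p \<in> I \<times> J" for p h
      using that comm[of "fst p" "snd p" h] by auto
    show "cinner (M p h) (M q h') = cinner (N p h) (N q h')"
      unfolding N_def gramM[OF p q] comm'[OF p] comm'[OF q]
      by (rule unitary_mixing_gram[OF _ u gramN0 p q, symmetric]) (use fin in auto)
    have "cinner (M p h) (N0 q h') = 0" for q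
      by (simp add: M_def N0_def cinner_add_left cinner_add_right \<iota>)
    then show "cinner (M p h) (N q h') = 0"
      by (simp add: N_def cinner_sum_right cinner_scaleC_right)
  qed
  then obtain G :: "('d room, 'a) ell2 \<Rightarrow> ('d room, 'a) ell2" where G: "unitary_operator G"
    and G_shift: "\<And>p z. p \<in> I \<times> J \<Longrightarrow>
      G (spread (\<lambda>(k, z). (Suc k, on_shuffle_coordinate (\<lambda>t. \<alpha> (fst p) (\<beta> (snd p) t)) z)) z) =
       (\<Sum>q\<in>I \<times> J. u p q *\<^sub>C spread (\<lambda>(k, z). (Suc k, on_shuffle_coordinate (\<lambda>t. \<beta> (snd q) (\<alpha> (fst q) t)) z)) (G z))"
    and G_M: "\<And>p h. p \<in> I \<times> J \<Longrightarrow> G (spread (Pair 0) (M p h)) = spread (Pair 0) (N p h)"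
    by blast
  have zero_block: "spread (Pair 0) (spread (\<iota> b c t) x) = spread (\<lambda>d. (0, b, c, t, d)) x"
    for b c t and x :: "('d, 'a) ell2"
    unfolding spread_spread[OF inj_Pair_left inj\<iota>] by (simp only: \<iota>_def)
  have shift_entrance: "spread (half_shift e) (spread (entrance c) x) =
      spread (\<lambda>d. (0, True, c, e 0, d)) x" if "inj e" for e c and x :: "('d, 'a) ell2"
    using that by (simp add: spread_spread inj_half_shift inj_entrance) (simp add: half_shift_def entrance_def)
  have entrance: "entrance c = (\<lambda>d::'d. (0, False, c, 0, d))" for c
    by (simp add: fun_eq_iff entrance_def)
  have M: "spread (Pair 0) (M (i, j) h) = dT i (S j h) + A i (dS j h)" if "i \<in> I" for i j h
    using inj\<alpha>[OF that]
    by (simp add: M_def clinear_add[OF clinear_spread] zero_block dT_def dS_def A_def shift_entrance)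
      (simp add: entrance)
  have N: "spread (Pair 0) (N0 q h) = dS (snd q) (T (fst q) h) + B (snd q) (dT (fst q) h)"
    if "q \<in> I \<times> J" for q h
    using inj\<beta>[of "snd q"] that
    by (auto simp: N0_def clinear_add[OF clinear_spread] zero_block dT_def dS_def B_def shift_entrance)
      (auto simp: entrance)
  have "G (A i (B j x)) = (\<Sum>q\<in>I \<times> J. u (i, j) q *\<^sub>C B (snd q) (A (fst q) (G x)))"
    if "i \<in> I" "j \<in> J" for i j x
  proof -
    have "A i (B j x) = spread (\<lambda>(k, z). (Suc k, on_shuffle_coordinate (\<lambda>t. \<alpha> i (\<beta> j t)) z)) x"
      using that by (simp add: A_def B_def spread_half_shift_twice inj\<alpha> inj\<beta>)
    then have "G (A i (B j x)) = (\<Sum>q\<in>I \<times> J. u (i, j) q *\<^sub>C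
        spread (\<lambda>(k, z). (Suc k, on_shuffle_coordinate (\<lambda>t. \<beta> (snd q) (\<alpha> (fst q) t)) z)) (G x))"
      using G_shift[of "(i, j)" x] that by simp
    also have "\<dots> = (\<Sum>q\<in>I \<times> J. u (i, j) q *\<^sub>C B (snd q) (A (fst q) (G x)))"
      by (intro sum.cong refl) (auto simp: A_def B_def spread_half_shift_twice inj\<alpha> inj\<beta>)
    finally show ?thesis .
  qed
  moreover have "G (dT i (S j h) + A i (dS j h)) =
      (\<Sum>q\<in>I \<times> J. u (i, j) q *\<^sub>C (dS (snd q) (T (fst q) h) + B (snd q) (dT (fst q) h)))"
    if "i \<in> I" "j \<in> J" for i j h
  proof -
    have "G (dT i (S j h) + A i (dS j h)) = spread (Pair 0) (N (i, j) h)"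
      using G_M[of "(i, j)" h] M that by simp
    also have "\<dots> = (\<Sum>q\<in>I \<times> J. u (i, j) q *\<^sub>C spread (Pair 0) (N0 q h))"
      by (simp add: N_def clinear_sum[OF clinear_spread] clinear_scaleC[OF clinear_spread])
    also have "\<dots> = (\<Sum>q\<in>I \<times> J. u (i, j) q *\<^sub>C (dS (snd q) (T (fst q) h) + B (snd q) (dT (fst q) h)))"
      by (intro sum.cong refl) (simp only: N)
    finally show ?thesis .
  qed
  ultimately show ?thesis using G by blast
qed

section \<open>The dilation\<close>

lemma dilates_single_iff:
  fixes C :: "'a::complex_inner \<Rightarrow> 'a" and i :: 'i
  shows "dilates (single i) B C \<longleftrightarrow> (\<forall>h. ell2_nth (B (single i h)) i = C h)"
proof -
  have "orth_proj (range (single i)) y = single i (ell2_nth y i)" for y :: "('i, 'a) ell2"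
    unfolding orth_proj_def
  proof (rule the_equality)
    show "single i (ell2_nth y i) \<in> range (single i) \<and>
        (\<forall>z\<in>range (single i). cinner (y - single i (ell2_nth y i)) z = 0)"
      by (auto simp: cinner_single_right ell2_nth_single)
  next
    fix y' assume y': "y' \<in> range (single i) \<and> (\<forall>z\<in>range (single i). cinner (y - y') z = 0)"
    then obtain h where h: "y' = single i h" by blast
    have "cinner (ell2_nth y i) h' = cinner h h'" for h'
      using y' by (auto simp: h cinner_single_right ell2_nth_single cinner_diff_left)
    then show "y' = single i (ell2_nth y i)" using cinner_eqI h by metis
  qed
  moreover have "single i h = single i h' \<longleftrightarrow> h = h'" for h h' :: 'a
    by (metis ell2_nth_single)
  ultimately show ?thesis by (simp add: dilates_def)
qed

lemma orth_compl_range_single: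
  "orth_compl_in UNIV (range (single i)) = {x :: ('i, 'a::complex_inner) ell2. ell2_nth x i = 0}"
proof -
  have "(\<forall>h. cinner (ell2_nth x i) h = 0) \<longleftrightarrow> ell2_nth x i = 0" for x :: "('i, 'a) ell2"
    by (metis cinner_eq_zero_iff cinner_zero_left)
  then show ?thesis by (auto simp: orth_compl_in_def cinner_single_right)
qed

text \<open>The added space is identified with the coordinates other than \<open>0\<close> of \<open>(nat, 'a) ell2\<close>, and \<open>H\<close>
  with the coordinate \<open>0\<close>.  Ando's choice is \<open>V\<^sub>i (h, l) = (T\<^sub>i h, G (dT\<^sub>i h + A\<^sub>i l))\<close> and
  \<open>U\<^sub>j (h, l) = (S\<^sub>j h, dS\<^sub>j h + B\<^sub>j (G\<^sup>-\<^sup>1 l))\<close>.  In \<open>U V\<close> the two factors \<open>G\<close> cancel, while in \<open>V U\<close> the outer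
  \<open>G\<close> carries the values of the uncorrected product to those of the product in the other order.\<close>

lemma triangular_dilation_exists:
  fixes T S :: "nat \<Rightarrow> 'a::complex_hilbert \<Rightarrow> 'a"
  assumes T: "\<And>i. i \<in> {1..n} \<Longrightarrow> bounded_operator_on UNIV (T i)"
    and S: "\<And>j. j \<in> {1..m} \<Longrightarrow> bounded_operator_on UNIV (S j)"
    and rowT: "row_contraction_on UNIV {1..n} T"
    and rowS: "row_contraction_on UNIV {1..m} S"
    and u: "unitary_matrix_on ({1..n} \<times> {1..m}) u"
    and comm: "\<And>i j h. i \<in> {1..n} \<Longrightarrow> j \<in> {1..m} \<Longrightarrow>
      T i (S j h) = (\<Sum>q\<in>{1..n} \<times> {1..m}. u (i, j) q *\<^sub>C S (snd q) (T (fst q) h))"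
  obtains V U :: "nat \<Rightarrow> (nat, 'a) ell2 \<Rightarrow> (nat, 'a) ell2" where
    "\<And>i. i \<in> {1..n} \<Longrightarrow> clinear_on UNIV (V i)"
    "\<And>j. j \<in> {1..m} \<Longrightarrow> clinear_on UNIV (U j)"
    "\<And>i x. i \<in> {1..n} \<Longrightarrow> ell2_nth (V i x) 0 = T i (ell2_nth x 0)"
    "\<And>j x. j \<in> {1..m} \<Longrightarrow> ell2_nth (U j x) 0 = S j (ell2_nth x 0)"
    "\<And>i k x y. i \<in> {1..n} \<Longrightarrow> k \<in> {1..n} \<Longrightarrow>
      cinner (V i x) (V k y) = (if i = k then cinner x y else 0)"
    "\<And>j l x y. j \<in> {1..m} \<Longrightarrow> l \<in> {1..m} \<Longrightarrow>
      cinner (U j x) (U l y) = (if j = l then cinner x y else 0)"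
    "\<And>i j x. i \<in> {1..n} \<Longrightarrow> j \<in> {1..m} \<Longrightarrow> V i (U j x) =
      (\<Sum>q\<in>{1..n} \<times> {1..m}. u (i, j) q *\<^sub>C U (snd q) (V (fst q) x))"
proof -
  have linT: "clinear_on UNIV (T i)" if "i \<in> {1..n}" for i
    using T[OF that] by (simp add: bounded_operator_on_def)
  have linS: "clinear_on UNIV (S j)" if "j \<in> {1..m}" for j
    using S[OF that] by (simp add: bounded_operator_on_def)
  obtain DT :: "nat \<Rightarrow> 'a \<Rightarrow> (nat + nat, 'a) ell2"
    where linDT: "\<And>i. i \<in> {1..n} \<Longrightarrow> clinear_on UNIV (DT i)"
      and DT: "\<And>i k h h'. i \<in> {1..n} \<Longrightarrow> k \<in> {1..n} \<Longrightarrow>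
        cinner (DT i h) (DT k h') = (if i = k then cinner h h' else 0) - cinner (T i h) (T k h')"
    using row_contraction_defect[OF finite_atLeastAtMost T rowT] by blast
  obtain DS :: "nat \<Rightarrow> 'a \<Rightarrow> (nat + nat, 'a) ell2"
    where linDS: "\<And>j. j \<in> {1..m} \<Longrightarrow> clinear_on UNIV (DS j)"
      and DS: "\<And>j l h h'. j \<in> {1..m} \<Longrightarrow> l \<in> {1..m} \<Longrightarrow>
        cinner (DS j h) (DS l h') = (if j = l then cinner h h' else 0) - cinner (S j h) (S l h')"
    using row_contraction_defect[OF finite_atLeastAtMost S rowS] by blast
  define dT where "dT i h = spread (entrance False) (DT i h)" for i h
  define dS where "dS j h = spread (entrance True) (DS j h)" for j h
  define A :: "nat \<Rightarrow> ((nat + nat) room, 'a) ell2 \<Rightarrow> ((nat + nat) room, 'a) ell2"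
    where "A i = spread (half_shift (\<lambda>p. p * n + (i - 1)))" for i
  define B :: "nat \<Rightarrow> ((nat + nat) room, 'a) ell2 \<Rightarrow> ((nat + nat) room, 'a) ell2"
    where "B j = spread (half_shift (\<lambda>p. p * m + (j - 1)))" for j
  have "\<exists>G :: ((nat + nat) room, 'a) ell2 \<Rightarrow> ((nat + nat) room, 'a) ell2. unitary_operator G \<and>
    (\<forall>i\<in>{1..n}. \<forall>j\<in>{1..m}. \<forall>x. G (A i (B j x)) =
      (\<Sum>q\<in>{1..n} \<times> {1..m}. u (i, j) q *\<^sub>C B (snd q) (A (fst q) (G x)))) \<and>
    (\<forall>i\<in>{1..n}. \<forall>j\<in>{1..m}. \<forall>h. G (dT i (S j h) + A i (dS j h)) =
      (\<Sum>q\<in>{1..n} \<times> {1..m}. u (i, j) q *\<^sub>C (dS (snd q) (T (fst q) h) + B (snd q) (dT (fst q) h))))"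
  proof (cases "n > 0 \<and> m > 0")
    \<comment> \<open>If one of the tuples is empty, there is no commutation relation and \<open>G = 1\<close> will do.\<close>
    case True
    then show ?thesis
      unfolding A_def B_def dT_def dS_def
      by (intro ando_unitary_exists[OF _ _ u comm DT DS] index_partition_residues) auto
  next
    case False
    then have "{1..n} = {} \<or> {1..m} = {}" by auto
    then show ?thesis using unitary_operator_id by blast
  qed
  then obtain G :: "((nat + nat) room, 'a) ell2 \<Rightarrow> ((nat + nat) room, 'a) ell2"
    where G: "unitary_operator G"
      and G_AB: "\<And>i j x. i \<in> {1..n} \<Longrightarrow> j \<in> {1..m} \<Longrightarrow> G (A i (B j x)) =
        (\<Sum>q\<in>{1..n} \<times> {1..m}. u (i, j) q *\<^sub>C B (snd q) (A (fst q) (G x)))"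
      and G_d: "\<And>i j h. i \<in> {1..n} \<Longrightarrow> j \<in> {1..m} \<Longrightarrow> G (dT i (S j h) + A i (dS j h)) =
        (\<Sum>q\<in>{1..n} \<times> {1..m}. u (i, j) q *\<^sub>C (dS (snd q) (T (fst q) h) + B (snd q) (dT (fst q) h)))"
    by blast
  note linG = unitary_operator_clinear[OF G] and G_inv = unitary_operator_inv[OF G]
  note linG' = unitary_operator_clinear[OF G_inv(1)]
  have linA: "clinear_on UNIV (A i)" and linB: "clinear_on UNIV (B j)" for i j
    by (simp_all add: A_def B_def clinear_spread)
  have lindT: "clinear_on UNIV (dT i)" if "i \<in> {1..n}" for i
    unfolding dT_def by (rule clinear_compose[OF clinear_spread linDT[OF that]])
  have lindS: "clinear_on UNIV (dS j)" if "j \<in> {1..m}" for j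
    unfolding dS_def by (rule clinear_compose[OF clinear_spread linDS[OF that]])
  have gram_shift: "cinner (spread (half_shift (\<lambda>p. p * r + (i - 1))) x) (spread (half_shift (\<lambda>p. p * r + (k - 1))) y) =
      (if i = k then cinner x y else 0)" if "i \<in> {1..r}" "k \<in> {1..r}"
    for r i k and x y :: "((nat + nat) room, 'a) ell2"
  proof -
    have part: "index_partition {1..r} (\<lambda>i p. p * r + (i - 1))"
      using that by (intro index_partition_residues) auto
    have inj: "inj (half_shift (\<lambda>p. p * r + (i - 1)))" if "i \<in> {1..r}" for i
      using index_partition_inj[OF part that] by (rule inj_half_shift)
    show ?thesis
    proof (cases "i = k")
      case True
      then show ?thesis using cinner_spread[OF inj[OF that(1)]] by simp
    next
      case False
      then have "half_shift (\<lambda>p. p * r + (i - 1)) x \<noteq> half_shift (\<lambda>p. p * r + (k - 1)) y" for x y :: "(nat + nat) room"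
        using index_partition_eq_iff[OF part that] by (auto simp: half_shift_eq_iff split: prod.splits)
      from cinner_spread_disjoint[OF inj[OF that(1)] this] False show ?thesis by simp
    qed
  qed
  have gram_dT: "cinner (dT i h + A i x) (dT k h' + A k y) =
      (if i = k then cinner h h' + cinner x y else 0) - cinner (T i h) (T k h')"
    if "i \<in> {1..n}" "k \<in> {1..n}" for i k h h' x y
  proof -
    have "cinner (dT i h) (A k y) = 0" "cinner (dT k h') (A i x) = 0"
      by (auto simp: dT_def A_def inj_entrance intro!: cinner_spread_disjoint half_shift_neq_entrance[symmetric])
    moreover from this have "cinner (A i x) (dT k h') = 0" by (metis cinner_commute complex_cnj_zero)
    moreover have "cinner (dT i h) (dT k h') = cinner (DT i h) (DT k h')"
      by (simp add: dT_def cinner_spread inj_entrance)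
    moreover have "cinner (A i x) (A k y) = (if i = k then cinner x y else 0)"
      unfolding A_def by (rule gram_shift[OF that])
    ultimately show ?thesis
      using DT[OF that] by (simp add: cinner_add_left cinner_add_right)
  qed
  have gram_dS: "cinner (dS j h + B j x) (dS l h' + B l y) =
      (if j = l then cinner h h' + cinner x y else 0) - cinner (S j h) (S l h')"
    if "j \<in> {1..m}" "l \<in> {1..m}" for j l h h' x y
  proof -
    have "cinner (dS j h) (B l y) = 0" "cinner (dS l h') (B j x) = 0"
      by (auto simp: dS_def B_def inj_entrance intro!: cinner_spread_disjoint half_shift_neq_entrance[symmetric])
    moreover from this have "cinner (B j x) (dS l h') = 0" by (metis cinner_commute complex_cnj_zero)
    moreover have "cinner (dS j h) (dS l h') = cinner (DS j h) (DS l h')"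
      by (simp add: dS_def cinner_spread inj_entrance)
    moreover have "cinner (B j x) (B l y) = (if j = l then cinner x y else 0)"
      unfolding B_def by (rule gram_shift[OF that])
    ultimately show ?thesis
      using DS[OF that] by (simp add: cinner_add_left cinner_add_right)
  qed
  \<comment> \<open>An enumeration of the indices of the added space by the positive numbers.\<close>
  obtain \<nu> :: "(nat + nat) room \<Rightarrow> nat" where \<nu>: "inj \<nu>" "range \<nu> = - {0}"
  proof -
    define e where "e = to_nat_on (UNIV :: (nat + nat) room set)"
    have "infinite (UNIV :: (nat + nat) room set)"
      by (simp add: finite_prod)
    then have "bij e"
      unfolding e_def by (intro to_nat_on_infinite) auto
    then have "inj (Suc \<circ> e)" "range (Suc \<circ> e) = Suc ` UNIV"
      by (auto simp: bij_def inj_compose image_comp[symmetric])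
    moreover have "range Suc = - {0}"
      by (auto simp: image_iff) (metis not0_implies_Suc)
    ultimately have "inj (Suc \<circ> e)" "range (Suc \<circ> e) = - {0}" by simp_all
    then show ?thesis by (rule that)
  qed
  define rest :: "(nat, 'a) ell2 \<Rightarrow> _" where "rest = gather \<nu>"
  define pair where "pair h l = single 0 h + spread \<nu> l" for h :: 'a and l
  have \<nu>0: "0 \<notin> range \<nu>" and \<nu>0': "\<nu> i \<noteq> 0" for i using \<nu>(2) by auto
  have pair: "ell2_nth (pair h l) 0 = h" "rest (pair h l) = l" for h l
  proof -
    show "ell2_nth (pair h l) 0 = h"
      using \<nu>0 by (simp add: pair_def ell2_nth_single ell2_nth_spread_outside)
    show "rest (pair h l) = l"
      by (rule ell2_eqI) (simp add: rest_def pair_def ell2_nth_gather \<nu> ell2_nth_single \<nu>0' ell2_nth_spread)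
  qed
  have eqI: "x = y" if "ell2_nth x 0 = ell2_nth y 0" "rest x = rest y" for x y
  proof (rule ell2_eqI)
    fix t show "ell2_nth x t = ell2_nth y t"
    proof (cases "t = 0")
      case False
      then obtain i where "t = \<nu> i" using \<nu>(2) by blast
      then show ?thesis using that(2) ell2_nth_gather[OF \<nu>(1)] unfolding rest_def by metis
    qed (use that(1) in simp)
  qed
  have split: "cinner x y = cinner (ell2_nth x 0) (ell2_nth y 0) + cinner (rest x) (rest y)" for x y
  proof -
    have "x = pair (ell2_nth x 0) (rest x)" by (rule eqI) (simp_all add: pair)
    then have "cinner x y = cinner (pair (ell2_nth x 0) (rest x)) y" by simp
    then show ?thesis
      by (simp add: pair_def cinner_add_left cinner_single_left cinner_spread_left[OF \<nu>(1)] rest_def)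
  qed
  have linrest: "clinear_on UNIV rest" unfolding rest_def by (rule clinear_gather)
  note lin0 = clinear_ell2_nth[of 0]
  define V where "V i x = pair (T i (ell2_nth x 0)) (G (dT i (ell2_nth x 0) + A i (rest x)))" for i x
  define U where "U j x = pair (S j (ell2_nth x 0)) (dS j (ell2_nth x 0) + B j (inv G (rest x)))" for j x
  have V: "ell2_nth (V i x) 0 = T i (ell2_nth x 0)" "rest (V i x) = G (dT i (ell2_nth x 0) + A i (rest x))"
    and U: "ell2_nth (U j x) 0 = S j (ell2_nth x 0)" "rest (U j x) = dS j (ell2_nth x 0) + B j (inv G (rest x))"
    for i j x by (simp_all add: V_def U_def pair)
  have linpair: "clinear_on UNIV (\<lambda>x. pair (f x) (g x))"
    if "clinear_on UNIV f" "clinear_on UNIV g" for f :: "(nat, 'a) ell2 \<Rightarrow> 'a" and g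
    unfolding pair_def
    by (intro clinear_plus clinear_compose[OF clinear_single that(1)] clinear_compose[OF clinear_spread that(2)])
  have linV: "clinear_on UNIV (V i)" if "i \<in> {1..n}" for i
    unfolding V_def
    by (intro linpair clinear_compose[OF linT[OF that] lin0] clinear_compose[OF linG] clinear_plus
        clinear_compose[OF lindT[OF that] lin0] clinear_compose[OF linA linrest])
  have linU: "clinear_on UNIV (U j)" if "j \<in> {1..m}" for j
    unfolding U_def
    by (intro linpair clinear_compose[OF linS[OF that] lin0] clinear_plus
        clinear_compose[OF lindS[OF that] lin0] clinear_compose[OF linB clinear_compose[OF linG' linrest]])
  have gramV: "cinner (V i x) (V k y) = (if i = k then cinner x y else 0)"
    if "i \<in> {1..n}" "k \<in> {1..n}" for i k x y
    using gram_dT[OF that]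
    by (simp add: split[of "V i x"] split[of x] V isometry_cinner[OF unitary_operator_isometry[OF G]])
  have gramU: "cinner (U j x) (U l y) = (if j = l then cinner x y else 0)"
    if "j \<in> {1..m}" "l \<in> {1..m}" for j l x y
    using gram_dS[OF that]
    by (simp add: split[of "U j x"] split[of x] U isometry_cinner[OF unitary_operator_isometry[OF G_inv(1)]])
  have VU: "V i (U j x) = (\<Sum>q\<in>{1..n} \<times> {1..m}. u (i, j) q *\<^sub>C U (snd q) (V (fst q) x))"
    if ij: "i \<in> {1..n}" "j \<in> {1..m}" for i j x
  proof (rule eqI)
    show "ell2_nth (V i (U j x)) 0 =
        ell2_nth (\<Sum>q\<in>{1..n} \<times> {1..m}. u (i, j) q *\<^sub>C U (snd q) (V (fst q) x)) 0"
      by (simp add: V U ell2_nth_sum comm[OF ij])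
    define h l where "h = ell2_nth x 0" and "l = inv G (rest x)"
    have "rest (V i (U j x)) = G (dT i (S j h) + A i (dS j h + B j l))"
      by (simp add: V U h_def l_def)
    also have "\<dots> = G (dT i (S j h) + A i (dS j h)) + G (A i (B j l))"
      by (simp add: clinear_add[OF linA] clinear_add[OF linG] add.assoc)
    also have "\<dots> = (\<Sum>q\<in>{1..n} \<times> {1..m}. u (i, j) q *\<^sub>C
        (dS (snd q) (T (fst q) h) + B (snd q) (dT (fst q) h + A (fst q) (G l))))"
      unfolding G_d[OF ij] G_AB[OF ij]
      by (simp add: clinear_add[OF linB] scaleC_add_right sum.distrib add.assoc)
    also have "\<dots> = rest (\<Sum>q\<in>{1..n} \<times> {1..m}. u (i, j) q *\<^sub>C U (snd q) (V (fst q) x))"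
      by (simp add: clinear_sum[OF linrest] clinear_scaleC[OF linrest] V U G_inv(2,3) h_def l_def)
    finally show "rest (V i (U j x)) = rest (\<Sum>q\<in>{1..n} \<times> {1..m}. u (i, j) q *\<^sub>C U (snd q) (V (fst q) x))" .
  qed
  show thesis
    by (rule that[of V U, OF linV linU V(1) U(1) gramV gramU VU])
qed

theorem corollary4p5:
  fixes T S :: "nat \<Rightarrow> 'a::complex_hilbert \<Rightarrow> 'a"
    and n m :: nat
    and u :: "nat \<times> nat \<Rightarrow> nat \<times> nat \<Rightarrow> complex"
  assumes "\<And>i. i \<in> {1..n} \<Longrightarrow> bounded_operator_on UNIV (T i)"
    and "\<And>j. j \<in> {1..m} \<Longrightarrow> bounded_operator_on UNIV (S j)"
    and "row_contraction_on UNIV {1..n} T"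
    and "row_contraction_on UNIV {1..m} S"
    and "unitary_matrix_on ({1..n} \<times> {1..m}) u"
    and "\<And>i j h. i \<in> {1..n} \<Longrightarrow> j \<in> {1..m} \<Longrightarrow>
           T i (S j h) = (\<Sum>(k, l) \<in> {1..n} \<times> {1..m}. u (i, j) (k, l) *\<^sub>C S l (T k h))"
  shows "\<exists>(K :: (nat, 'a) ell2 set) (J :: 'a \<Rightarrow> (nat, 'a) ell2)
            (V :: nat \<Rightarrow> (nat, 'a) ell2 \<Rightarrow> (nat, 'a) ell2)
            (U :: nat \<Rightarrow> (nat, 'a) ell2 \<Rightarrow> (nat, 'a) ell2).
      closed_csubspace K \<and> isometry_on UNIV J \<and> range J \<subseteq> K \<and>
      (\<forall>i\<in>{1..n}. bounded_operator_on K (V i) \<and> isometry_on K (V i)) \<and>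
      (\<forall>j\<in>{1..m}. bounded_operator_on K (U j) \<and> isometry_on K (U j)) \<and>
      row_contraction_on K {1..n} V \<and> row_contraction_on K {1..m} U \<and>
      (\<forall>i\<in>{1..n}. \<forall>k\<in>{1..n}. i \<noteq> k \<longrightarrow> (\<forall>x\<in>K. \<forall>y\<in>K. cinner (V i x) (V k y) = 0)) \<and>
      (\<forall>j\<in>{1..m}. \<forall>l\<in>{1..m}. j \<noteq> l \<longrightarrow> (\<forall>x\<in>K. \<forall>y\<in>K. cinner (U j x) (U l y) = 0)) \<and>
      (\<forall>i\<in>{1..n}. \<forall>j\<in>{1..m}. \<forall>x\<in>K.
         V i (U j x) = (\<Sum>(k, l) \<in> {1..n} \<times> {1..m}. u (i, j) (k, l) *\<^sub>C U l (V k x))) \<and>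
      (\<forall>i\<in>{1..n}. V i ` orth_compl_in K (range J) \<subseteq> orth_compl_in K (range J)) \<and>
      (\<forall>j\<in>{1..m}. U j ` orth_compl_in K (range J) \<subseteq> orth_compl_in K (range J)) \<and>
      (\<forall>i\<in>{1..n}. dilates J (V i) (T i)) \<and>
      (\<forall>j\<in>{1..m}. dilates J (U j) (S j)) \<and>
      (\<forall>w. set w \<subseteq> Inl ` {1..n} \<union> Inr ` {1..m} \<longrightarrow>
         dilates J (word_op V U w) (word_op T S w))"
proof -
  have TS: "T i (S j h) = (\<Sum>q\<in>{1..n} \<times> {1..m}. u (i, j) q *\<^sub>C S (snd q) (T (fst q) h))"
    if "i \<in> {1..n}" "j \<in> {1..m}" for i j h
    using assms(6)[OF that] by (simp add: case_prod_unfold)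
  show ?thesis
  proof (rule triangular_dilation_exists[OF assms(1-5) TS])
    fix V U :: "nat \<Rightarrow> (nat, 'a) ell2 \<Rightarrow> (nat, 'a) ell2"
    assume linV: "\<And>i. i \<in> {1..n} \<Longrightarrow> clinear_on UNIV (V i)"
      and linU: "\<And>j. j \<in> {1..m} \<Longrightarrow> clinear_on UNIV (U j)"
      and V0: "\<And>i x. i \<in> {1..n} \<Longrightarrow> ell2_nth (V i x) 0 = T i (ell2_nth x 0)"
      and U0: "\<And>j x. j \<in> {1..m} \<Longrightarrow> ell2_nth (U j x) 0 = S j (ell2_nth x 0)"
      and gramV: "\<And>i k x y. i \<in> {1..n} \<Longrightarrow> k \<in> {1..n} \<Longrightarrow>
        cinner (V i x) (V k y) = (if i = k then cinner x y else 0)"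
      and gramU: "\<And>j l x y. j \<in> {1..m} \<Longrightarrow> l \<in> {1..m} \<Longrightarrow>
        cinner (U j x) (U l y) = (if j = l then cinner x y else 0)"
      and comm: "\<And>i j x. i \<in> {1..n} \<Longrightarrow> j \<in> {1..m} \<Longrightarrow> V i (U j x) =
        (\<Sum>q\<in>{1..n} \<times> {1..m}. u (i, j) q *\<^sub>C U (snd q) (V (fst q) x))"
    have isoV: "isometry_on UNIV (V i)" if "i \<in> {1..n}" for i
      using isometryI[OF linV[OF that]] gramV[OF that that] by simp
    have isoU: "isometry_on UNIV (U j)" if "j \<in> {1..m}" for j
      using isometryI[OF linU[OF that]] gramU[OF that that] by simp
    have bdd: "bounded_operator_on UNIV W" if "isometry_on UNIV W" for W :: "(nat, 'a) ell2 \<Rightarrow> (nat, 'a) ell2"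
      using that by (auto simp: bounded_operator_on_def isometry_on_def intro!: exI[of _ 1])
    have words: "ell2_nth (word_op V U w x) 0 = word_op T S w (ell2_nth x 0)"
      if "set w \<subseteq> Inl ` {1..n} \<union> Inr ` {1..m}" for w x
      using that by (induction w arbitrary: x) (auto simp: V0 U0)
    have zero: "T i 0 = 0" if "i \<in> {1..n}" for i
      using assms(1)[OF that] by (auto simp: bounded_operator_on_def intro: clinear_zero)
    have zero': "S j 0 = 0" if "j \<in> {1..m}" for j
      using assms(2)[OF that] by (auto simp: bounded_operator_on_def intro: clinear_zero)
    show ?thesis
    proof (intro exI conjI)
      show "closed_csubspace (UNIV :: (nat, 'a) ell2 set)" by (simp add: closed_csubspace_def)
      show "isometry_on UNIV (single 0 :: 'a \<Rightarrow> (nat, 'a) ell2)"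
        by (rule isometryI[OF clinear_single]) (simp add: cinner_single_left ell2_nth_single)
      show "range (single 0 :: 'a \<Rightarrow> (nat, 'a) ell2) \<subseteq> UNIV" by simp
      show "\<forall>i\<in>{1..n}. bounded_operator_on UNIV (V i) \<and> isometry_on UNIV (V i)"
        using isoV bdd by blast
      show "\<forall>j\<in>{1..m}. bounded_operator_on UNIV (U j) \<and> isometry_on UNIV (U j)"
        using isoU bdd by blast
      show "row_contraction_on UNIV {1..n} V"
        by (rule row_contraction_of_isometries) (use gramV bdd isoV in auto)
      show "row_contraction_on UNIV {1..m} U"
        by (rule row_contraction_of_isometries) (use gramU bdd isoU in auto)
      show "\<forall>i\<in>{1..n}. \<forall>k\<in>{1..n}. i \<noteq> k \<longrightarrow> (\<forall>x\<in>UNIV. \<forall>y\<in>UNIV. cinner (V i x) (V k y) = 0)"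
        by (simp add: gramV)
      show "\<forall>j\<in>{1..m}. \<forall>l\<in>{1..m}. j \<noteq> l \<longrightarrow> (\<forall>x\<in>UNIV. \<forall>y\<in>UNIV. cinner (U j x) (U l y) = 0)"
        by (simp add: gramU)
      show "\<forall>i\<in>{1..n}. \<forall>j\<in>{1..m}. \<forall>x\<in>UNIV.
          V i (U j x) = (\<Sum>(k, l) \<in> {1..n} \<times> {1..m}. u (i, j) (k, l) *\<^sub>C U l (V k x))"
        by (simp add: comm case_prod_unfold)
      show "\<forall>i\<in>{1..n}. V i ` orth_compl_in UNIV (range (single 0)) \<subseteq> orth_compl_in UNIV (range (single 0))"
        by (auto simp: orth_compl_range_single V0 zero)
      show "\<forall>j\<in>{1..m}. U j ` orth_compl_in UNIV (range (single 0)) \<subseteq> orth_compl_in UNIV (range (single 0))"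
        by (auto simp: orth_compl_range_single U0 zero')
      show "\<forall>i\<in>{1..n}. dilates (single 0) (V i) (T i)"
        by (simp add: dilates_single_iff V0 ell2_nth_single)
      show "\<forall>j\<in>{1..m}. dilates (single 0) (U j) (S j)"
        by (simp add: dilates_single_iff U0 ell2_nth_single)
      show "\<forall>w. set w \<subseteq> Inl ` {1..n} \<union> Inr ` {1..m} \<longrightarrow>
          dilates (single 0) (word_op V U w) (word_op T S w)"
        by (simp add: dilates_single_iff words ell2_nth_single)
    qed
  qed
qed

end
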